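(* Let $n\geq 2$. There exists a constant $C_n>0$ depending only on $n$ such that, for every smooth, bounded domain $\Omega\subset\mathbb R^n$ and every integer $k\geq 1$, $$|\partial\Omega|^{\frac{1}{n-1}}\,\sigma_k(\Omega)\leq C_n\, I(\Omega)^{\frac{1}{n-1}}\,k^{\frac 1{n-1}},$$ where $I(\Omega)=\dfrac{|\partial\Omega|}{|\Omega|^{\frac{n-1}{n}}}$ is the isoperimetric ratio of $\Omega$.
   Context: A domain is a connected open set; $|\Omega|$ denotes the $n$-dimensional Lebesgue measure of $\Omega$ and $|\partial\Omega|$ the $(n-1)$-dimensional measure of its boundary. The Steklov eigenvalues of a smooth, bounded domain $\Omega\subset\mathbb R^n$ are the numbers $\sigma$ for which the problem $$\sum_{i=1}^n\partial_{ii}^2u=0 \text{ in }\Omega,\qquad \partial_N u=\sigma u\text{ on }\partial\Omega$$ ($N$ the outer unit normal) has a nontrivial solution; they form a sequence, repeated according to multiplicity, indexed starting from $1$: $$0=\sigma_1(\Omega)<\sigma_2(\Omega)\leq\cdots\leq\sigma_k(\Omega)\leq\cdots\nearrow+\infty .$$ Equivalently, $$\sigma_k(\Omega)=\min_{\substack{V\subset H^1(\Omega)\\ \dim V=k}}\ \max_{0\neq\phi\in V}\frac{\int_\Omega|\nabla\phi|^2}{\int_{\partial\Omega}\phi^2},$$ where the quotient is understood as $+\infty$ when the trace of $\phi\ne0$ on $\partial\Omega$ vanishes. *)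

theory Defs
  imports "HOL-Analysis.Analysis"
begin

section \<open>Smooth functions and smooth domains\<close>

fun Ck_on :: "nat \<Rightarrow> 'a::real_normed_vector set \<Rightarrow> ('a \<Rightarrow> 'b::real_normed_vector) \<Rightarrow> bool" where
  "Ck_on 0 U f \<longleftrightarrow> continuous_on U f"
| "Ck_on (Suc m) U f \<longleftrightarrow>
     (\<forall>x\<in>U. f differentiable (at x)) \<and> (\<forall>v. Ck_on m U (\<lambda>x. frechet_derivative f (at x) v))"

definition smooth_on :: "'a::real_normed_vector set \<Rightarrow> ('a \<Rightarrow> 'b::real_normed_vector) \<Rightarrow> bool" where
  "smooth_on U f \<longleftrightarrow> (\<forall>m. Ck_on m U f)"

definition grad :: "(real^'n \<Rightarrow> real) \<Rightarrow> real^'n \<Rightarrow> real^'n" where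
  "grad f x = (\<chi> i. frechet_derivative f (at x) (axis i 1))"

text \<open>Near each of its points the boundary is the regular zero set of a smooth function that is
  negative inside and nonnegative outside; the domain lies locally on one side of its boundary.\<close>

definition smooth_boundary :: "(real^'n) set \<Rightarrow> bool" where
  "smooth_boundary \<Omega> \<longleftrightarrow>
     (\<forall>p\<in>frontier \<Omega>. \<exists>U g. open U \<and> p \<in> U \<and> smooth_on U (g :: real^'n \<Rightarrow> real) \<and>
        (\<forall>x\<in>U. grad g x \<noteq> 0) \<and> \<Omega> \<inter> U = {x\<in>U. g x < 0})"

definition smooth_bounded_domain :: "(real^'n) set \<Rightarrow> bool" where
  "smooth_bounded_domain \<Omega> \<longleftrightarrow>
     \<Omega> \<noteq> {} \<and> open \<Omega> \<and> connected \<Omega> \<and> bounded \<Omega> \<and> smooth_boundary \<Omega>"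


section \<open>Boundary measure\<close>

text \<open>The Hausdorff measure, normalised so that in dimension \<open>d\<close> it agrees with Lebesgue measure.
  Coverings are required to be bounded because \<^const>\<open>diameter\<close> is unspecified on unbounded sets.\<close>

definition hausdorff_gauge :: "nat \<Rightarrow> 'a::metric_space set \<Rightarrow> ennreal" where
  "hausdorff_gauge d S =
     (if S = {} then 0 else ennreal (unit_ball_vol (real d) * (diameter S / 2) ^ d))"

definition hausdorff_premeasure :: "nat \<Rightarrow> real \<Rightarrow> 'a::metric_space set \<Rightarrow> ennreal" where
  "hausdorff_premeasure d \<delta> A =
     (INF S \<in> {S :: nat \<Rightarrow> 'a set. A \<subseteq> (\<Union>i. S i) \<and> (\<forall>i. bounded (S i) \<and> diameter (S i) \<le> \<delta>)}.
        \<Sum>i. hausdorff_gauge d (S i))"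

definition hausdorff_outer :: "nat \<Rightarrow> 'a::metric_space set \<Rightarrow> ennreal" where
  "hausdorff_outer d A = (SUP \<delta>\<in>{0<..}. hausdorff_premeasure d \<delta> A)"

definition hausdorff_measure :: "nat \<Rightarrow> 'a::metric_space measure" where
  "hausdorff_measure d = measure_of UNIV (sets borel) (hausdorff_outer d)"

definition boundary_measure :: "(real^'n) set \<Rightarrow> (real^'n) measure" where
  "boundary_measure \<Omega> = restrict_space (hausdorff_measure (CARD('n) - 1)) (frontier \<Omega>)"

definition boundary_area :: "(real^'n) set \<Rightarrow> real" where
  "boundary_area \<Omega> = measure (boundary_measure \<Omega>) (frontier \<Omega>)"

definition isoperimetric_ratio :: "(real^'n) set \<Rightarrow> real" where
  "isoperimetric_ratio \<Omega> =
     boundary_area \<Omega> / measure lebesgue \<Omega> powr ((real CARD('n) - 1) / real CARD('n))"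


section \<open>The Sobolev space \<open>H\<^sup>1(\<Omega>)\<close> and traces\<close>

definition square_integrable :: "'a measure \<Rightarrow> ('a \<Rightarrow> 'b::euclidean_space) \<Rightarrow> bool" where
  "square_integrable M f \<longleftrightarrow> f \<in> borel_measurable M \<and> integrable M (\<lambda>x. (norm (f x))\<^sup>2)"

definition test_function :: "(real^'n) set \<Rightarrow> (real^'n \<Rightarrow> real) \<Rightarrow> bool" where
  "test_function \<Omega> \<psi> \<longleftrightarrow>
     smooth_on UNIV \<psi> \<and> compact (closure {x. \<psi> x \<noteq> 0}) \<and> closure {x. \<psi> x \<noteq> 0} \<subseteq> \<Omega>"

text \<open>\<open>H1_gradient \<Omega> u G\<close>: \<open>u\<close> represents an element of \<open>H\<^sup>1(\<Omega>)\<close> and its weak gradient is \<open>G\<close>.\<close>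

definition H1_gradient :: "(real^'n) set \<Rightarrow> (real^'n \<Rightarrow> real) \<Rightarrow> (real^'n \<Rightarrow> real^'n) \<Rightarrow> bool" where
  "H1_gradient \<Omega> u G \<longleftrightarrow>
     square_integrable (lebesgue_on \<Omega>) u \<and> square_integrable (lebesgue_on \<Omega>) G \<and>
     (\<forall>\<psi> i. test_function \<Omega> \<psi> \<longrightarrow>
        (LINT x|lebesgue_on \<Omega>. u x * grad \<psi> x $ i) = - (LINT x|lebesgue_on \<Omega>. G x $ i * \<psi> x))"

text \<open>The graph of the trace operator \<open>H\<^sup>1(\<Omega>) \<rightarrow> L\<^sup>2(\<partial>\<Omega>)\<close>, the continuous extension of restriction to the
  boundary from the functions smooth up to the boundary.\<close>

definition has_trace :: "(real^'n) set \<Rightarrow> (real^'n \<Rightarrow> real) \<Rightarrow> (real^'n \<Rightarrow> real) \<Rightarrow> bool" where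
  "has_trace \<Omega> u T \<longleftrightarrow>
     square_integrable (boundary_measure \<Omega>) T \<and>
     (\<exists>G w. H1_gradient \<Omega> u G \<and> (\<forall>j::nat. smooth_on UNIV (w j)) \<and>
        (\<lambda>j. \<integral>\<^sup>+x. ennreal ((w j x - u x)\<^sup>2 + (norm (grad (w j) x - G x))\<^sup>2) \<partial>lebesgue_on \<Omega>)
          \<longlonglongrightarrow> 0 \<and>
        (\<lambda>j. \<integral>\<^sup>+x. ennreal ((w j x - T x)\<^sup>2) \<partial>boundary_measure \<Omega>) \<longlonglongrightarrow> 0)"


section \<open>Steklov eigenvalues\<close>

text \<open>The Rayleigh quotient of a function with weak gradient \<open>G\<close> and trace \<open>T\<close>.\<close>

definition rayleigh :: "(real^'n) set \<Rightarrow> (real^'n \<Rightarrow> real^'n) \<Rightarrow> (real^'n \<Rightarrow> real) \<Rightarrow> ennreal" where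
  "rayleigh \<Omega> G T =
     (let E = \<integral>\<^sup>+x. ennreal ((norm (G x))\<^sup>2) \<partial>lebesgue_on \<Omega>;
          B = \<integral>\<^sup>+x. ennreal ((T x)\<^sup>2) \<partial>boundary_measure \<Omega>
      in if B = 0 then \<infinity> else E / B)"

text \<open>\<open>H1_frame \<Omega> k \<phi> G T\<close>: the \<open>\<phi> i\<close>, \<open>i < k\<close>, form a basis of a \<open>k\<close>-dimensional subspace of \<open>H\<^sup>1(\<Omega>)\<close>
  (functions being identified when equal almost everywhere), with gradients \<open>G i\<close> and traces \<open>T i\<close>.
  By linearity \<open>\<Sum>i<k. c i * \<phi> i\<close> has gradient \<open>\<Sum>i<k. c i *\<^sub>R G i\<close> and trace \<open>\<Sum>i<k. c i * T i\<close>.\<close>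

definition H1_frame :: "(real^'n) set \<Rightarrow> nat \<Rightarrow> (nat \<Rightarrow> real^'n \<Rightarrow> real) \<Rightarrow>
    (nat \<Rightarrow> real^'n \<Rightarrow> real^'n) \<Rightarrow> (nat \<Rightarrow> real^'n \<Rightarrow> real) \<Rightarrow> bool" where
  "H1_frame \<Omega> k \<phi> G T \<longleftrightarrow>
     (\<forall>i<k. H1_gradient \<Omega> (\<phi> i) (G i) \<and> has_trace \<Omega> (\<phi> i) (T i)) \<and>
     (\<forall>c. (AE x in lebesgue_on \<Omega>. (\<Sum>i<k. c i * \<phi> i x) = 0) \<longrightarrow> (\<forall>i<k. c i = 0))"

text \<open>The \<open>k\<close>-th Steklov eigenvalue, \<open>k \<ge> 1\<close>, counted with multiplicity and starting from
  \<open>\<sigma>\<^sub>1 = 0\<close>: the minimum over all \<open>k\<close>-dimensional subspaces of \<open>H\<^sup>1(\<Omega>)\<close> of the maximum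
  of the Rayleigh quotient over the nonzero elements.\<close>

definition steklov_eigenvalue :: "(real^'n) set \<Rightarrow> nat \<Rightarrow> ennreal" where
  "steklov_eigenvalue \<Omega> k =
     (INF (\<phi>, G, T) \<in> {(\<phi>, G, T). H1_frame \<Omega> k \<phi> G T}.
        SUP c \<in> {c :: nat \<Rightarrow> real. \<exists>i<k. c i \<noteq> 0}.
          rayleigh \<Omega> (\<lambda>x. \<Sum>i<k. c i *\<^sub>R G i x) (\<lambda>x. \<Sum>i<k. c i * T i x))"

end

theory Submission
  imports Defs
begin

text \<open>
  Write \<open>V = |\<Omega>|\<close>. Since \<open>I(\<Omega>)\<close> contains the factor \<open>|\<partial>\<Omega>|\<close>, the claim amounts to
  \<open>\<sigma>\<^sub>k(\<Omega>) \<le> C V\<^sup>-\<^sup>1\<^sup>/\<^sup>n k\<^sup>1\<^sup>/\<^sup>(\<^sup>n\<^sup>-\<^sup>1\<^sup>)\<close>, that is \<open>\<sigma>\<^sub>k(\<Omega>) \<le> C / s\<close> on the length scale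
  \<open>s\<close> with \<open>(V\<^sup>1\<^sup>/\<^sup>n / s)\<^sup>n\<^sup>-\<^sup>1 \<approx> k\<close>. By the variational characterisation it suffices to find \<open>k\<close> bump
  functions with disjoint supports in balls of radius about \<open>s\<close>, each with Rayleigh quotient \<open>\<le> C / s\<close>.

  A relative isoperimetric inequality
  \<open>|\<Omega> \<inter> D| |D - \<Omega>| \<le> C d\<^sup>n\<^sup>+\<^sup>1 |\<partial>\<Omega> \<inter> D|\<close> for convex \<open>D\<close> of diameter \<open>d\<close> bounds the boundary mass of a
  ball from below: a segment from \<open>\<Omega> \<inter> D\<close> to \<open>D - \<Omega>\<close> meets \<open>\<partial>\<Omega> \<inter> D\<close>, and for a fixed direction the
  segments meeting a set of diameter \<open>r\<close> start in a tube of volume at most \<open>C d r\<^sup>n\<^sup>-\<^sup>1\<close>.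

  To find the balls, partition space into cubes of side \<open>s\<close>. If half of the volume of \<open>\<Omega>\<close> lies in
  cubes that \<open>\<Omega>\<close> fills at most half, averaging yields about \<open>V / s\<^sup>n\<close> such cubes that
  also carry a fixed share of the volume of \<open>\<Omega>\<close> in a surrounding ball. Otherwise there are about
  \<open>V / s\<^sup>n\<close> cubes filled more than half, and the discrete isoperimetric inequality yields about
  \<open>(V / s\<^sup>n)\<^sup>(\<^sup>n\<^sup>-\<^sup>1\<^sup>)\<^sup>/\<^sup>n\<close> of them having a neighbour that is not.
\<close>

section \<open>Bump functions\<close>

text \<open>The powers of \<open>inverse t\<close> make the family closed under differentiation up
  to linear combinations, so that smoothness can be proved for all orders at once.\<close>

definition flat :: "nat \<Rightarrow> real \<Rightarrow> real" where
  "flat k t = (if t > 0 then inverse t ^ k * exp (- inverse t) else 0)"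

lemma flat_nonneg: "flat k t \<ge> 0"
  by (simp add: flat_def)

lemma flat_tendsto_0: "(flat k \<longlongrightarrow> 0) (at_right 0)"
proof -
  have "((\<lambda>x::real. x ^ k / exp x) \<longlongrightarrow> 0) at_top"
    by (rule tendsto_power_div_exp_0)
  then have "((\<lambda>t::real. inverse t ^ k / exp (inverse t)) \<longlongrightarrow> 0) (at_right 0)"
    by (rule filterlim_compose[OF _ filterlim_inverse_at_top_right])
  moreover have "\<forall>\<^sub>F t in at_right 0. inverse t ^ k / exp (inverse t) = flat k t"
    using eventually_at_right_less[of 0]
    by eventually_elim (simp add: flat_def exp_minus divide_inverse)
  ultimately show ?thesis
    by (rule Lim_transform_eventually)
qed

text \<open>For \<open>t > 0\<close> this is the product rule. At \<open>0\<close> the right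
  difference quotient of \<open>flat k\<close> is \<open>flat (Suc k)\<close> itself, which tends to
  \<open>0\<close> because the exponential beats every power, and the left one vanishes.\<close>

lemma flat_has_derivative:
  "(flat k has_real_derivative (flat (k + 2) t - real k * flat (k + 1) t)) (at t)"
proof (cases t "0 :: real" rule: linorder_cases)
  case less
  have "(flat k has_real_derivative 0) (at t) \<longleftrightarrow> ((\<lambda>_. 0) has_real_derivative 0) (at t)"
  proof (rule DERIV_cong_ev[OF refl _ refl])
    show "\<forall>\<^sub>F x in nhds t. flat k x = 0"
      using eventually_nhds_in_open[OF open_lessThan, of t 0] less
      by (auto simp: flat_def elim!: eventually_mono)
  qed
  then show ?thesis
    using less by (simp add: flat_def)
next
  case equal
  have "((\<lambda>h. (flat k (0 + h) - flat k 0) / h) \<longlongrightarrow> 0) (at 0)"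
  proof (rule filterlim_split_at)
    have "\<forall>\<^sub>F h in at_left 0. (flat k (0 + h) - flat k 0) / h = (0::real)"
      using eventually_at_left_real[of "-1" 0] by (auto simp: flat_def elim!: eventually_mono)
    then show "((\<lambda>h. (flat k (0 + h) - flat k 0) / h) \<longlongrightarrow> 0) (at_left 0)"
      by (simp add: tendsto_eventually)
    have "\<forall>\<^sub>F h in at_right 0. flat (Suc k) h = (flat k (0 + h) - flat k 0) / h"
      using eventually_at_right_less[of 0]
      by eventually_elim (simp add: flat_def field_simps)
    then show "((\<lambda>h. (flat k (0 + h) - flat k 0) / h) \<longlongrightarrow> 0) (at_right 0)"
      by (rule Lim_transform_eventually[OF flat_tendsto_0])
  qed
  then show ?thesis
    using equal by (simp add: DERIV_def flat_def)
next
  case greater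
  have "((\<lambda>t. inverse t ^ k * exp (- inverse t)) has_real_derivative
      (flat (k + 2) t - real k * flat (k + 1) t)) (at t)"
  \<comment> \<open>The power rule leaves the exponent \<open>k - 1\<close>, which natural
    subtraction truncates at \<open>k = 0\<close>.\<close>
  proof (cases k)
    case (Suc m)
    have "((\<lambda>t. inverse t ^ k * exp (- inverse t)) has_real_derivative
        inverse t ^ k * (exp (- inverse t) * (inverse t * inverse t)) +
        real k * inverse t ^ (k - 1) * (- (inverse t * inverse t)) * exp (- inverse t)) (at t)"
      using greater by (auto intro!: derivative_eq_intros)
    then show ?thesis
      by (rule DERIV_cong) (use greater Suc in \<open>simp add: flat_def algebra_simps\<close>)
  qed (use greater in \<open>auto intro!: derivative_eq_intros simp: flat_def power2_eq_square\<close>)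
  moreover have ev: "\<forall>\<^sub>F x in nhds t. flat k x = inverse x ^ k * exp (- inverse x)"
    using eventually_nhds_in_open[OF open_greaterThan, of t 0] greater
    by (auto simp: flat_def elim!: eventually_mono)
  ultimately show ?thesis
    by (subst DERIV_cong_ev[OF refl ev refl])
qed

section \<open>Smoothness of functions built from the bump profile\<close>

lemma ball_profile_has_derivative:
  fixes p :: "'a::real_inner"
  shows "((\<lambda>x. 1 - (norm (x - p))\<^sup>2 / R\<^sup>2) has_derivative (\<lambda>v. ((x - p) \<bullet> v) * (- 2 / R\<^sup>2))) (at x)"
proof -
  have "((\<lambda>x. (norm (x - p))\<^sup>2) has_derivative (\<lambda>v. (x - p) \<bullet> v + v \<bullet> (x - p))) (at x)"
    unfolding power2_norm_eq_inner
    by (intro has_derivative_inner) (auto intro!: derivative_eq_intros)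
  then have "((\<lambda>x. 1 - inverse (R\<^sup>2) * (norm (x - p))\<^sup>2) has_derivative
      (\<lambda>v. 0 - inverse (R\<^sup>2) * ((x - p) \<bullet> v + v \<bullet> (x - p)))) (at x)"
    by (intro has_derivative_diff has_derivative_const has_derivative_mult_right)
  then show ?thesis
    by (simp add: divide_inverse mult_ac inner_commute[of "x - p"])
qed

text \<open>Chosen as a class of functions closed under directional derivatives: the chain rule on
  the \<open>flat\<close> generators produces further \<open>flat\<close> terms times an affine
  function of \<open>x\<close>, hence the constants, the linear functions and the products.\<close>

inductive bump_algebra :: "'a::euclidean_space \<Rightarrow> real \<Rightarrow> ('a \<Rightarrow> real) \<Rightarrow> bool" for p R where
  const: "bump_algebra p R (\<lambda>x. c)"
| inner: "bump_algebra p R (\<lambda>x. x \<bullet> v)"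
| flat: "bump_algebra p R (\<lambda>x. flat k (1 - (norm (x - p))\<^sup>2 / R\<^sup>2))"
| add: "bump_algebra p R f \<Longrightarrow> bump_algebra p R g \<Longrightarrow> bump_algebra p R (\<lambda>x. f x + g x)"
| mult: "bump_algebra p R f \<Longrightarrow> bump_algebra p R g \<Longrightarrow> bump_algebra p R (\<lambda>x. f x * g x)"

lemma bump_algebra_derivative:
  assumes "bump_algebra p R f"
  shows "\<exists>f'. \<forall>x. (f has_derivative f' x) (at x) \<and> (\<forall>v. bump_algebra p R (\<lambda>x. f' x v))"
  using assms
proof induction
  case (const c)
  show ?case
    by (rule exI[of _ "\<lambda>x v. 0"]) (auto intro: bump_algebra.const)
next
  case (inner v)
  show ?case
    by (rule exI[of _ "\<lambda>x w. w \<bullet> v"])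
      (auto intro: bump_algebra.const intro!: derivative_eq_intros)
next
  case (flat k)
  let ?\<theta> = "\<lambda>x. 1 - (norm (x - p))\<^sup>2 / R\<^sup>2"
  \<comment> \<open>Differences are written as sums with a negated term because the algebra has
    closure rules for sums and products only.\<close>
  define f' where "f' x v = (flat (k + 2) (?\<theta> x) + (- real k) * flat (k + 1) (?\<theta> x)) *
      ((x \<bullet> v + (- (p \<bullet> v))) * (- 2 / R\<^sup>2))" for x v
  have "((\<lambda>x. flat k (?\<theta> x)) has_derivative f' x) (at x)" for x
  proof -
    note th = ball_profile_has_derivative[of p R x]
    show ?thesis
      using has_derivative_compose[OF th flat_has_derivative[unfolded has_field_derivative_def]]
      by (simp add: f'_def[abs_def] inner_diff_left)
  qed
  moreover have "bump_algebra p R (\<lambda>x. f' x v)" for v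
    unfolding f'_def by (intro bump_algebra.intros)
  ultimately show ?case by blast
next
  case (add f g)
  then obtain f' g' where
    "\<And>x. (f has_derivative f' x) (at x)" "\<And>v. bump_algebra p R (\<lambda>x. f' x v)"
    "\<And>x. (g has_derivative g' x) (at x)" "\<And>v. bump_algebra p R (\<lambda>x. g' x v)"
    by metis
  then show ?case
    by (intro exI[of _ "\<lambda>x v. f' x v + g' x v"])
      (auto intro!: bump_algebra.intros derivative_intros)
next
  case (mult f g)
  then obtain f' g' where
    "\<And>x. (f has_derivative f' x) (at x)" "\<And>v. bump_algebra p R (\<lambda>x. f' x v)"
    "\<And>x. (g has_derivative g' x) (at x)" "\<And>v. bump_algebra p R (\<lambda>x. g' x v)"
    by metis
  then show ?case
    using mult.hyps
    by (intro exI[of _ "\<lambda>x v. f x * g' x v + f' x v * g x"])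
      (auto intro!: bump_algebra.intros derivative_intros)
qed

text \<open>\<open>Ck_on (Suc m)\<close> asks for \<open>Ck_on m\<close> of all directional
  derivatives, which lie in the algebra again; the induction on \<open>m\<close> therefore runs over
  all members simultaneously.\<close>

lemma bump_algebra_smooth:
  assumes "bump_algebra p R f"
  shows "smooth_on UNIV f"
proof -
  have "Ck_on m UNIV f" for m
    using assms
  proof (induction m arbitrary: f)
    case 0
    then obtain f' where "\<And>x. (f has_derivative f' x) (at x)"
      using bump_algebra_derivative by blast
    then show ?case
      by (auto intro!: continuous_at_imp_continuous_on has_derivative_continuous)
  next
    case (Suc m)
    then obtain f' where f': "\<And>x. (f has_derivative f' x) (at x)" "\<And>v. bump_algebra p R (\<lambda>x. f' x v)"
      using bump_algebra_derivative by blast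
    then have "frechet_derivative f (at x) = f' x" for x
      by (metis frechet_derivative_at)
    with f' Suc.IH show ?case
      by (auto simp: differentiable_def)
  qed
  then show ?thesis
    by (simp add: smooth_on_def)
qed

text \<open>For \<open>R > 0\<close> this is the standard mollifier
  \<open>exp (- 1 / (1 - |x - p|^2 / R^2))\<close> of the ball, without normalisation.\<close>

definition bump :: "'a::euclidean_space \<Rightarrow> real \<Rightarrow> 'a \<Rightarrow> real" where
  "bump p R x = flat 0 (1 - (norm (x - p))\<^sup>2 / R\<^sup>2)"

lemma smooth_bump: "smooth_on UNIV (bump p R)"
  unfolding bump_def[abs_def] by (rule bump_algebra_smooth[OF bump_algebra.flat])

section \<open>Support and size of the bump and of its gradient\<close>

lemma bump_eq_0: "bump p R x = 0" if "R > 0" "x \<notin> ball p R"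
proof -
  have "R \<le> norm (x - p)" using that by (simp add: dist_norm norm_minus_commute)
  then have "R\<^sup>2 \<le> (norm (x - p))\<^sup>2" using that by (intro power_mono) auto
  then have "1 \<le> (norm (x - p))\<^sup>2 / R\<^sup>2" using that by simp
  then show ?thesis by (simp add: bump_def flat_def)
qed

lemma bump_pos: "bump p R x > 0" if "x \<in> ball p R"
proof -
  have "norm (x - p) < R" using that by (simp add: dist_norm norm_minus_commute)
  then have "(norm (x - p))\<^sup>2 < R\<^sup>2" "R > 0"
    by (auto intro!: power_strict_mono) (meson le_less_trans norm_ge_zero)
  then have "(norm (x - p))\<^sup>2 / R\<^sup>2 < 1" by simp
  then show ?thesis by (simp add: bump_def flat_def)
qed

lemma bump_lower_bound: "bump p R x \<ge> exp (-2)" if "R > 0" "x \<in> ball p (R/2)"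
proof -
  have "norm (x - p) \<le> R/2" using that by (simp add: dist_norm norm_minus_commute)
  then have "(norm (x - p))\<^sup>2 \<le> (R/2)\<^sup>2" by (intro power_mono) auto
  then have *: "(norm (x - p))\<^sup>2 / R\<^sup>2 \<le> 1/4"
    using that by (simp add: power_divide pos_divide_le_eq)
  \<comment> \<open>The profile is at least 3/4 here; rounding it down to 1/2 gives the exponent
    2.\<close>
  then have "inverse (1 - (norm (x - p))\<^sup>2 / R\<^sup>2) \<le> inverse (1/2)"
    by (intro le_imp_inverse_le; linarith)
  moreover have "0 < 1 - (norm (x - p))\<^sup>2 / R\<^sup>2"
    using * by linarith
  ultimately show ?thesis by (simp add: bump_def flat_def)
qed

text \<open>With \<open>x = inverse t\<close> this is \<open>x^2 / 2 <= exp x\<close>, read off the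
  quadratic Taylor bound.\<close>

lemma flat_2_le: "flat 2 t \<le> 2"
proof (cases "t > 0")
  case True
  then have "(inverse t)\<^sup>2 / 2 \<le> exp (inverse t)"
    using exp_lower_Taylor_quadratic[of "inverse t"] positive_imp_inverse_positive[of t]
    by linarith
  then have "(inverse t)\<^sup>2 * exp (- inverse t) \<le> (2 * exp (inverse t)) * exp (- inverse t)"
    by (intro mult_right_mono) auto
  then show ?thesis
    using True by (simp add: flat_def mult.assoc flip: exp_add)
qed (simp add: flat_def)

lemma bump_has_derivative:
  "(bump p R has_derivative
     (\<lambda>v. ((x - p) \<bullet> v) * (- 2 / R\<^sup>2 * flat 2 (1 - (norm (x - p))\<^sup>2 / R\<^sup>2)))) (at x)"
proof -
  let ?\<theta> = "\<lambda>x. 1 - (norm (x - p))\<^sup>2 / R\<^sup>2"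
  note th = ball_profile_has_derivative[of p R x]
  show ?thesis
    using has_derivative_compose[OF th flat_has_derivative[of 0, unfolded has_field_derivative_def]]
    by (simp add: bump_def[abs_def] mult_ac numeral_2_eq_2)
qed

lemma grad_bump:
  "grad (bump p R) x = (- 2 / R\<^sup>2 * flat 2 (1 - (norm (x - p))\<^sup>2 / R\<^sup>2)) *\<^sub>R (x - p)"
  unfolding grad_def frechet_derivative_at[OF bump_has_derivative, symmetric]
  by (simp add: vec_eq_iff inner_axis mult_ac)

lemma grad_bump_eq_0: "grad (bump p R) x = 0" if "R > 0" "x \<notin> ball p R"
proof -
  have "R \<le> norm (x - p)" using that by (simp add: dist_norm norm_minus_commute)
  then have "R\<^sup>2 \<le> (norm (x - p))\<^sup>2" using that by (intro power_mono) auto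
  then have "1 \<le> (norm (x - p))\<^sup>2 / R\<^sup>2" using that by simp
  then show ?thesis by (simp add: grad_bump flat_def)
qed

lemma norm_grad_bump_le:
  assumes "R > 0"
  shows "norm (grad (bump p R) x) \<le> 4 / R"
proof (cases "x \<in> ball p R")
  case True
  then have "norm (x - p) \<le> R" by (simp add: dist_norm norm_minus_commute)
  then have "2 / R\<^sup>2 * flat 2 (1 - (norm (x - p))\<^sup>2 / R\<^sup>2) * norm (x - p) \<le> 2 / R\<^sup>2 * 2 * R"
    using assms flat_2_le flat_nonneg by (intro mult_mono) auto
  also have "\<dots> = 4 / R" using assms by (simp add: power2_eq_square)
  finally show ?thesis
    by (simp add: grad_bump abs_mult flat_nonneg)
qed (use assms grad_bump_eq_0[of R x p] in auto)

section \<open>Smooth functions as elements of the Sobolev space\<close>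

lemma derivative_eq_0_outside_closed:
  assumes "(u has_derivative u') (at x)" "closed K" "\<And>x. x \<notin> K \<Longrightarrow> u x = 0" "x \<notin> K"
  shows "u' v = 0"
proof -
  have "(u has_derivative (\<lambda>_. 0)) (at x)"
    by (rule has_derivative_transform_within_open[where f = "\<lambda>_. 0" and s = "- K"])
      (use assms in auto)
  then show ?thesis
    using assms(1) has_derivative_unique by blast
qed

text \<open>The integral of a difference quotient vanishes by translation invariance.\<close>

lemma integral_directional_derivative_eq_0:
  fixes u :: "'a::euclidean_space \<Rightarrow> real"
  assumes der: "\<And>x. (u has_derivative u' x) (at x)"
    and cont: "continuous_on UNIV (\<lambda>x. u' x e)"
    and K: "compact K" "\<And>x. x \<notin> K \<Longrightarrow> u x = 0"
  shows "integral\<^sup>L lborel (\<lambda>x. u' x e) = 0"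
proof -
  have contu: "continuous_on UNIV u"
    using der by (auto intro!: continuous_at_imp_continuous_on has_derivative_continuous)
  then have [measurable]: "u \<in> borel_measurable borel"
    by (rule borel_measurable_continuous_onI)
  have [measurable]: "(\<lambda>x. u' x e) \<in> borel_measurable borel"
    using cont by (rule borel_measurable_continuous_onI)
  have u'0: "u' x e = 0" if "x \<notin> K" for x
    by (rule derivative_eq_0_outside_closed[OF der compact_imp_closed[OF K(1)] K(2) that])
  obtain B where B: "\<And>x. norm (u' x e) \<le> B" "B \<ge> 0"
  proof -
    have "compact ((\<lambda>x. u' x e) ` K)"
      using K cont by (auto intro: compact_continuous_image continuous_on_subset)
    then obtain B where "\<forall>y\<in>(\<lambda>x. u' x e) ` K. norm y \<le> B"
      using compact_imp_bounded bounded_iff by metis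
    then have "norm (u' x e) \<le> max B 0" for x
      using u'0 by (cases "x \<in> K") (force simp: le_max_iff_disj)+
    then show thesis
      using that by (meson max.cobounded2)
  qed
  have line: "((\<lambda>t. u (x + t *\<^sub>R e)) has_real_derivative u' (x + t *\<^sub>R e) e) (at t)" for x t
  proof -
    have "((\<lambda>t. u (x + t *\<^sub>R e)) has_derivative (\<lambda>s. u' (x + t *\<^sub>R e) (s *\<^sub>R e))) (at t)"
      by (rule has_derivative_compose[OF _ der]) (auto intro!: derivative_eq_intros)
    then show ?thesis
      unfolding has_field_derivative_def
      by (rule has_derivative_eq_rhs)
        (simp add: fun_eq_iff linear_cmul[OF has_derivative_linear[OF der]] mult.commute)
  qed
  define h :: "nat \<Rightarrow> real" where "h j = inverse (real (Suc j))" for j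
  have h: "h j > 0" "h j \<le> 1" for j
    by (auto simp: h_def field_simps)
  \<comment> \<open>This compact set contains every \<open>x\<close> for which some
    \<open>x + t e\<close> with \<open>0 <= t <= 1\<close> lies in \<open>K\<close>. By the mean
    value theorem all difference quotients with steps \<open>h j <= 1\<close> vanish off
    \<open>K'\<close> and are bounded by \<open>B\<close> on it, which supplies the dominating
    function.\<close>
  define K' where "K' = (\<lambda>(x, t). x - t *\<^sub>R e) ` (K \<times> {0..1})"
  have "compact K'"
    unfolding K'_def using K
    by (intro compact_continuous_image compact_Times)
      (auto intro!: continuous_intros simp: case_prod_unfold)
  have bnd: "norm ((u (x + h j *\<^sub>R e) - u x) / h j) \<le> indicator K' x * B" for x j
  proof -
    obtain t where t: "0 < t" "t < h j" "u (x + h j *\<^sub>R e) - u x = h j * u' (x + t *\<^sub>R e) e"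
      using MVT2[OF h(1)[of j], of "\<lambda>t. u (x + t *\<^sub>R e)" "\<lambda>t. u' (x + t *\<^sub>R e) e"] line
      by auto
    then have eq: "(u (x + h j *\<^sub>R e) - u x) / h j = u' (x + t *\<^sub>R e) e"
      using h(1)[of j] by simp
    show ?thesis
    proof (cases "x + t *\<^sub>R e \<in> K")
      case True
      have "t \<in> {0..1}" using t h(2)[of j] by auto
      then have "x \<in> K'"
        using True by (auto simp: K'_def intro!: image_eqI[of _ _ "(x + t *\<^sub>R e, t)"])
      then show ?thesis unfolding eq using B by simp
    qed (use B u'0 in \<open>simp add: eq\<close>)
  qed
  have ui: "integrable lborel u"
  proof -
    have "integrable lborel (\<lambda>x. indicator K x *\<^sub>R u x)"
      using K contu by (intro borel_integrable_compact) (auto intro: continuous_on_subset)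
    moreover have "(\<lambda>x. indicator K x *\<^sub>R u x) = u"
    proof
      show "indicator K x *\<^sub>R u x = u x" for x
        using K(2)[of x] by (cases "x \<in> K") auto
    qed
    ultimately show ?thesis by (rule back_subst[where P = "integrable lborel"])
  qed
  have quot0: "integral\<^sup>L lborel (\<lambda>x. (u (x + h j *\<^sub>R e) - u x) / h j) = 0" for j
  proof -
    have i2: "integrable lborel (\<lambda>x. u (x + h j *\<^sub>R e))"
      "integral\<^sup>L lborel (\<lambda>x. u (x + h j *\<^sub>R e)) = integral\<^sup>L lborel u"
    proof -
      have "integrable (distr lborel borel ((+) (h j *\<^sub>R e))) u"
        using ui by (simp add: lborel_distr_plus)
      then show "integrable lborel (\<lambda>x. u (x + h j *\<^sub>R e))"
        by (subst (asm) integrable_distr_eq) (auto simp: add.commute)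
      have "integral\<^sup>L (distr lborel borel ((+) (h j *\<^sub>R e))) u = integral\<^sup>L lborel (\<lambda>x. u (x + h j *\<^sub>R e))"
        by (subst integral_distr) (auto simp: add.commute)
      then show "integral\<^sup>L lborel (\<lambda>x. u (x + h j *\<^sub>R e)) = integral\<^sup>L lborel u"
        by (simp add: lborel_distr_plus)
    qed
    show ?thesis
      using i2 ui by simp
  qed
  have "(\<lambda>j. integral\<^sup>L lborel (\<lambda>x. (u (x + h j *\<^sub>R e) - u x) / h j))
      \<longlonglongrightarrow> integral\<^sup>L lborel (\<lambda>x. u' x e)"
  proof (rule integral_dominated_convergence[where w = "\<lambda>x. indicator K' x * B"])
    have "emeasure lborel K' < \<infinity>"
      using \<open>compact K'\<close> emeasure_compact_finite by blast
    then show "integrable lborel (\<lambda>x. indicator K' x * B)"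
      using \<open>compact K'\<close> by (intro integrable_mult_left) (auto intro!: borel_compact)
    show "AE x in lborel. (\<lambda>j. (u (x + h j *\<^sub>R e) - u x) / h j) \<longlonglongrightarrow> u' x e"
    proof (rule AE_I2)
      fix x
      have "((\<lambda>t. (u (x + t *\<^sub>R e) - u x) / t) \<longlongrightarrow> u' x e) (at 0)"
        using line[of x 0] by (simp add: DERIV_def)
      moreover have "filterlim h (at 0) sequentially"
      proof -
        have "h \<longlonglongrightarrow> 0"
          unfolding h_def by (rule LIMSEQ_inverse_real_of_nat)
        then show ?thesis
          using h(1) by (intro filterlim_atI) (auto simp: less_imp_neq[symmetric])
      qed
      ultimately show "(\<lambda>j. (u (x + h j *\<^sub>R e) - u x) / h j) \<longlonglongrightarrow> u' x e"
        by (rule filterlim_compose)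
    qed
  qed (use bnd in auto)
  then show ?thesis
    unfolding quot0 by (simp add: LIMSEQ_const_iff)
qed

lemma smooth_onD:
  assumes "smooth_on UNIV f"
  shows "(f has_derivative frechet_derivative f (at x)) (at x)"
    and "continuous_on UNIV (\<lambda>x. frechet_derivative f (at x) v)"
    and "continuous_on UNIV f"
proof -
  have "Ck_on 1 UNIV f" "Ck_on 0 UNIV f"
    using assms by (auto simp: smooth_on_def simp del: Ck_on.simps)
  then show "(f has_derivative frechet_derivative f (at x)) (at x)"
    "continuous_on UNIV (\<lambda>x. frechet_derivative f (at x) v)" "continuous_on UNIV f"
    by (auto simp: frechet_derivative_works)
qed

lemma continuous_on_grad: "smooth_on UNIV f \<Longrightarrow> continuous_on UNIV (grad f)"
  unfolding grad_def[abs_def] by (intro continuous_on_vec_lambda smooth_onD)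

lemma square_integrable_continuous:
  fixes f :: "'a::euclidean_space \<Rightarrow> 'b::euclidean_space"
  assumes f: "continuous_on UNIV f" and [measurable]: "f \<in> borel_measurable M"
    and M: "bounded (space M)" "emeasure M (space M) < \<infinity>"
  shows "square_integrable M f"
proof -
  interpret finite_measure M
    using M by (intro finite_measureI) auto
  have "bounded (f ` closure (space M))"
    using M f by (intro compact_imp_bounded compact_continuous_image)
      (auto intro: continuous_on_subset simp: compact_closure)
  then obtain B where "\<forall>y\<in>f ` closure (space M). norm y \<le> B"
    unfolding bounded_iff by auto
  then have B: "norm (f x) \<le> B" if "x \<in> space M" for x
    using that closure_subset[of "space M"] by auto
  have "integrable M (\<lambda>x. (norm (f x))\<^sup>2)"
    by (rule integrable_const_bound[where B = "B\<^sup>2"]) (auto intro!: AE_I2 power_mono B)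
  then show ?thesis
    by (simp add: square_integrable_def)
qed

lemma borel_measurable_lebesgue_on_continuous:
  fixes f :: "'a::euclidean_space \<Rightarrow> 'b::euclidean_space"
  assumes "continuous_on UNIV f"
  shows "f \<in> borel_measurable (lebesgue_on \<Omega>)"
  using borel_measurable_continuous_onI[OF assms]
  by (intro measurable_restrict_space1 measurable_completion) simp

lemma square_integrable_lebesgue_on_continuous:
  fixes f :: "'a::euclidean_space \<Rightarrow> 'b::euclidean_space"
  assumes "continuous_on UNIV f" "open \<Omega>" "bounded \<Omega>"
  shows "square_integrable (lebesgue_on \<Omega>) f"
proof (rule square_integrable_continuous[OF assms(1) borel_measurable_lebesgue_on_continuous[OF assms(1)]])
  have "emeasure lborel \<Omega> < \<infinity>"
    using assms emeasure_bounded_finite by blast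
  then show "emeasure (lebesgue_on \<Omega>) (space (lebesgue_on \<Omega>)) < \<infinity>"
    using assms by (simp add: emeasure_restrict_space)
qed (use assms in simp)

lemma lebesgue_on_integral_eq_lborel:
  fixes f :: "'a::euclidean_space \<Rightarrow> real"
  assumes "f \<in> borel_measurable borel" "open \<Omega>" "\<And>x. x \<notin> \<Omega> \<Longrightarrow> f x = 0"
  shows "integral\<^sup>L (lebesgue_on \<Omega>) f = integral\<^sup>L lborel f"
proof -
  have "(\<lambda>x. indicat_real \<Omega> x *\<^sub>R f x) = f"
  proof
    show "indicat_real \<Omega> x *\<^sub>R f x = f x" for x
      using assms(3)[of x] by (cases "x \<in> \<Omega>") auto
  qed
  moreover have "integral\<^sup>L (lebesgue_on \<Omega>) f = integral\<^sup>L lebesgue (\<lambda>x. indicat_real \<Omega> x *\<^sub>R f x)"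
    using assms by (subst integral_restrict_space) auto
  ultimately have "integral\<^sup>L (lebesgue_on \<Omega>) f = integral\<^sup>L lebesgue f"
    by (metis (no_types))
  also have "\<dots> = integral\<^sup>L lborel f"
    using assms(1) by (intro integral_completion) simp
  finally show ?thesis .
qed

text \<open>The product of \<open>\<phi>\<close> with a test function has compact support, so the
  integral of its partial derivative vanishes; the product rule turns this into integration by
  parts.\<close>

lemma H1_gradient_smooth:
  fixes \<phi> :: "real^'n \<Rightarrow> real"
  assumes \<phi>: "smooth_on UNIV \<phi>" and \<Omega>: "open \<Omega>" "bounded \<Omega>"
  shows "H1_gradient \<Omega> \<phi> (grad \<phi>)"
  unfolding H1_gradient_def
proof (intro conjI allI impI)
  show "square_integrable (lebesgue_on \<Omega>) \<phi>" "square_integrable (lebesgue_on \<Omega>) (grad \<phi>)"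
    using \<Omega> smooth_onD[OF \<phi>] continuous_on_grad[OF \<phi>]
    by (auto intro: square_integrable_lebesgue_on_continuous)
next
  fix \<psi> i
  assume "test_function \<Omega> \<psi>"
  then obtain K where \<psi>: "smooth_on UNIV \<psi>" and K: "compact K" "K \<subseteq> \<Omega>"
    and \<psi>0: "\<And>x. x \<notin> K \<Longrightarrow> \<psi> x = 0"
    unfolding test_function_def using closure_subset[of "{x. \<psi> x \<noteq> 0}"] by blast
  let ?e = "axis i 1 :: real^'n"
  let ?D = "\<lambda>f x. frechet_derivative f (at x)"
  have D\<psi>0: "?D \<psi> x ?e = 0" if "x \<notin> K" for x
    by (rule derivative_eq_0_outside_closed[OF smooth_onD(1)[OF \<psi>] compact_imp_closed[OF K(1)] \<psi>0 that])
  have int: "integrable lborel f" if "continuous_on UNIV f" "\<And>x. x \<notin> K \<Longrightarrow> f x = 0"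
    for f :: "real^'n \<Rightarrow> real"
  proof -
    have "integrable lborel (\<lambda>x. indicator K x *\<^sub>R f x)"
      using K that(1) by (intro borel_integrable_compact) (auto intro: continuous_on_subset)
    moreover have "(\<lambda>x. indicator K x *\<^sub>R f x) = f"
    proof
      show "indicator K x *\<^sub>R f x = f x" for x
        using that(2)[of x] by (cases "x \<in> K") auto
    qed
    ultimately show ?thesis by (rule back_subst[where P = "integrable lborel"])
  qed
  have c1: "continuous_on UNIV (\<lambda>x. \<phi> x * ?D \<psi> x ?e)" and c2: "continuous_on UNIV (\<lambda>x. ?D \<phi> x ?e * \<psi> x)"
    by (intro continuous_intros smooth_onD[OF \<phi>] smooth_onD[OF \<psi>])+
  have "integral\<^sup>L lborel (\<lambda>x. \<phi> x * ?D \<psi> x ?e + ?D \<phi> x ?e * \<psi> x) = 0"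
  proof (rule integral_directional_derivative_eq_0)
    show "((\<lambda>x. \<phi> x * \<psi> x) has_derivative (\<lambda>v. \<phi> x * ?D \<psi> x v + ?D \<phi> x v * \<psi> x)) (at x)" for x
      by (intro has_derivative_mult smooth_onD[OF \<phi>] smooth_onD[OF \<psi>])
    show "continuous_on UNIV (\<lambda>x. \<phi> x * ?D \<psi> x ?e + ?D \<phi> x ?e * \<psi> x)"
      by (intro continuous_on_add c1 c2)
    show "\<phi> x * \<psi> x = 0" if "x \<notin> K" for x
      by (simp add: \<psi>0[OF that])
  qed (rule K)
  moreover have "integrable lborel (\<lambda>x. \<phi> x * ?D \<psi> x ?e)" "integrable lborel (\<lambda>x. ?D \<phi> x ?e * \<psi> x)"
  proof -
    show "integrable lborel (\<lambda>x. \<phi> x * ?D \<psi> x ?e)"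
      by (rule int[OF c1]) (simp add: D\<psi>0)
    show "integrable lborel (\<lambda>x. ?D \<phi> x ?e * \<psi> x)"
      by (rule int[OF c2]) (simp add: \<psi>0)
  qed
  ultimately have "integral\<^sup>L lborel (\<lambda>x. \<phi> x * ?D \<psi> x ?e) = - integral\<^sup>L lborel (\<lambda>x. ?D \<phi> x ?e * \<psi> x)"
    by (simp add: add_eq_0_iff2)
  moreover have "(LINT x|lebesgue_on \<Omega>. \<phi> x * grad \<psi> x $ i) = integral\<^sup>L lborel (\<lambda>x. \<phi> x * ?D \<psi> x ?e)"
  proof -
    have "\<phi> x * ?D \<psi> x ?e = 0" if "x \<notin> \<Omega>" for x
    proof -
      have "x \<notin> K" using that K(2) by blast
      then show ?thesis by (simp add: D\<psi>0)
    qed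
    then show ?thesis
      unfolding grad_def vec_lambda_beta
      by (rule lebesgue_on_integral_eq_lborel[OF borel_measurable_continuous_onI[OF c1] \<Omega>(1)])
  qed
  moreover have "(LINT x|lebesgue_on \<Omega>. grad \<phi> x $ i * \<psi> x) = integral\<^sup>L lborel (\<lambda>x. ?D \<phi> x ?e * \<psi> x)"
  proof -
    have "?D \<phi> x ?e * \<psi> x = 0" if "x \<notin> \<Omega>" for x
    proof -
      have "x \<notin> K" using that K(2) by blast
      then show ?thesis by (simp add: \<psi>0)
    qed
    then show ?thesis
      unfolding grad_def vec_lambda_beta
      by (rule lebesgue_on_integral_eq_lborel[OF borel_measurable_continuous_onI[OF c2] \<Omega>(1)])
  qed
  ultimately show "(LINT x|lebesgue_on \<Omega>. \<phi> x * grad \<psi> x $ i) = - (LINT x|lebesgue_on \<Omega>. grad \<phi> x $ i * \<psi> x)"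
    by simp
qed

section \<open>Boundary measure and traces\<close>

lemma sets_hausdorff_measure [simp]: "sets (hausdorff_measure d) = sets borel"
  unfolding hausdorff_measure_def
  by (subst sets_measure_of) (use sets.sigma_sets_eq[of borel] in auto)

lemma space_hausdorff_measure [simp]: "space (hausdorff_measure d) = UNIV"
  by (simp add: hausdorff_measure_def)

text \<open>The constant sequence \<open>\<phi>\<close> serves as the approximating sequence, which
  leaves only square integrability on the boundary to be shown.\<close>

lemma has_trace_smooth:
  fixes \<phi> :: "real^'n \<Rightarrow> real"
  assumes \<phi>: "smooth_on UNIV \<phi>" and \<Omega>: "open \<Omega>" "bounded \<Omega>" and A: "boundary_area \<Omega> \<noteq> 0"
  shows "has_trace \<Omega> \<phi> \<phi>"
  unfolding has_trace_def
proof (intro conjI exI)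
  show "H1_gradient \<Omega> \<phi> (grad \<phi>)"
    by (rule H1_gradient_smooth[OF \<phi> \<Omega>])
  have sp: "space (boundary_measure \<Omega>) = frontier \<Omega>"
    by (simp add: boundary_measure_def space_restrict_space)
  show "square_integrable (boundary_measure \<Omega>) \<phi>"
  proof (rule square_integrable_continuous[OF smooth_onD(3)[OF \<phi>]])
    show "\<phi> \<in> borel_measurable (boundary_measure \<Omega>)"
      unfolding boundary_measure_def
      using borel_measurable_continuous_onI[OF smooth_onD(3)[OF \<phi>]]
      by (intro measurable_restrict_space1) (simp add: measurable_def)
    \<comment> \<open>\<open>measure\<close> sends infinite mass to 0, so a nonzero area means
      finite mass.\<close>
    have "emeasure (boundary_measure \<Omega>) (frontier \<Omega>) \<noteq> top"
      using A by (auto simp: boundary_area_def measure_def)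
    then show "emeasure (boundary_measure \<Omega>) (space (boundary_measure \<Omega>)) < \<infinity>"
      by (simp only: sp less_top infinity_ennreal_def)
  qed (use \<Omega> bounded_closure[of \<Omega>] in \<open>auto simp: sp frontier_def\<close>)
  show "\<forall>j::nat. smooth_on UNIV ((\<lambda>_. \<phi>) j)" using \<phi> by simp
qed auto

section \<open>A relative isoperimetric inequality\<close>

text \<open>Since \<open>x = w - t v\<close> means \<open>x + t v = w\<close>, these are the
  starting points \<open>x\<close> for which the segment from \<open>x\<close> to
  \<open>x + v\<close> comes within distance \<open>r\<close> of \<open>y\<close>.\<close>

definition tube :: "'a::real_normed_vector \<Rightarrow> real \<Rightarrow> 'a \<Rightarrow> 'a set" where
  "tube y r v = (\<lambda>(t, w). w - t *\<^sub>R v) ` ({0..1} \<times> cball y r)"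

lemma compact_tube: "compact (tube y r v)"
  for y :: "'a::euclidean_space"
  unfolding tube_def
  by (intro compact_continuous_image compact_Times)
    (auto intro!: continuous_intros simp: case_prod_unfold)

lemma tube_mono: "r \<le> r' \<Longrightarrow> tube y r v \<subseteq> tube y r' v"
  unfolding tube_def by (intro image_mono Sigma_mono subset_cball) auto

text \<open>At most \<open>3 d / r\<close> balls of radius \<open>2 r\<close> are used to cover a
  tube, each of volume \<open>2 ^ n * unit_ball_vol n * r ^ n\<close>.\<close>

definition tube_const :: "nat \<Rightarrow> real" where
  "tube_const n = 3 * 2 ^ n * unit_ball_vol n"

lemma tube_const_pos: "tube_const n > 0"
  by (simp add: tube_const_def)

text \<open>A chain of about \<open>d / r\<close> balls of radius \<open>2 r\<close> covers the tube.\<close>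

lemma emeasure_tube_le_aux:
  fixes y :: "'a::euclidean_space"
  assumes r: "0 < r" "r \<le> d" and v: "norm v \<le> d"
  shows "emeasure lborel (tube y r v) \<le> ennreal (tube_const DIM('a) * d * r ^ (DIM('a) - 1))"
proof -
  \<comment> \<open>Then \<open>N r >= d >= norm v\<close>, so neighbouring centres are at most
    \<open>r\<close> apart and every tube point is within \<open>r + r\<close> of a centre.\<close>
  define N where "N = nat \<lceil>d / r\<rceil>"
  have N: "d / r \<le> real N" "real N \<le> d / r + 1"
    using r unfolding N_def by (simp_all add: of_nat_nat)
  have "1 \<le> d / r" using r by simp
  then have N1: "N \<ge> 1" using N by linarith
  have cover: "tube y r v \<subseteq> (\<Union>j\<in>{..N}. cball (y - (real j / N) *\<^sub>R v) (2 * r))"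
  proof
    fix x assume "x \<in> tube y r v"
    then obtain t w where t: "0 \<le> t" "t \<le> 1" and w: "dist y w \<le> r" and x: "x = w - t *\<^sub>R v"
      by (auto simp: tube_def)
    define j where "j = nat \<lfloor>t * N\<rfloor>"
    have j: "real j \<le> t * N" "t * N \<le> real j + 1"
      using t by (auto simp: j_def)
    have "t * N \<le> 1 * real N" using t by (intro mult_right_mono) auto
    then have jN: "j \<le> N" using j by linarith
    have "\<bar>t - real j / N\<bar> * real N = \<bar>(t - real j / N) * real N\<bar>"
      by (simp add: abs_mult)
    also have "\<dots> \<le> 1"
      using j N1 by (simp add: left_diff_distrib)
    finally have tj: "\<bar>t - real j / N\<bar> * real N \<le> 1" .
    have "\<bar>t - real j / N\<bar> * norm v \<le> \<bar>t - real j / N\<bar> * (real N * r)"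
    proof (intro mult_left_mono)
      have "d \<le> real N * r" using N(1) r by (simp add: pos_divide_le_eq)
      then show "norm v \<le> real N * r" using v by linarith
    qed auto
    also have "\<dots> \<le> r"
      using mult_right_mono[OF tj, of r] r by (simp add: mult_ac)
    finally have "norm ((t - real j / N) *\<^sub>R v) \<le> r" by simp
    moreover have "norm (y - w) \<le> r" using w by (simp add: dist_norm)
    moreover have eq: "(y - (real j / N) *\<^sub>R v) - x = (y - w) + (t - real j / N) *\<^sub>R v"
      by (simp add: x algebra_simps)
    ultimately have "dist (y - (real j / N) *\<^sub>R v) x \<le> 2 * r"
      unfolding dist_norm eq using norm_triangle_ineq[of "y - w" "(t - real j / N) *\<^sub>R v"] by linarith
    then show "x \<in> (\<Union>j\<in>{..N}. cball (y - (real j / N) *\<^sub>R v) (2 * r))"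
      using jN by auto
  qed
  let ?n = "DIM('a)"
  have "emeasure lborel (tube y r v)
      \<le> emeasure lborel (\<Union>j\<in>{..N}. cball (y - (real j / N) *\<^sub>R v) (2 * r))"
    using cover by (intro emeasure_mono) auto
  also have "\<dots> \<le> (\<Sum>j\<in>{..N}. emeasure lborel (cball (y - (real j / N) *\<^sub>R v) (2 * r)))"
    by (intro emeasure_subadditive_finite) auto
  also have "\<dots> = of_nat (N + 1) * ennreal (unit_ball_vol ?n * (2 * r) ^ ?n)"
    using r by (simp add: emeasure_cball)
  also have "\<dots> = ennreal (real (N + 1) * (unit_ball_vol ?n * (2 * r) ^ ?n))"
    by (simp add: ennreal_mult' ennreal_of_nat_eq_real_of_nat)
  also have "\<dots> \<le> ennreal (tube_const ?n * d * r ^ (?n - 1))"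
  proof (rule ennreal_leI)
    have "real (N + 1) \<le> 3 * (d / r)"
      using N \<open>1 \<le> d / r\<close> by linarith
    then have "real (N + 1) * (unit_ball_vol ?n * (2 * r) ^ ?n)
        \<le> 3 * (d / r) * (unit_ball_vol ?n * (2 * r) ^ ?n)"
      using r by (intro mult_right_mono) auto
    also have "\<dots> = 3 * (d / r) * (unit_ball_vol ?n * (2 ^ ?n * (r * r ^ (?n - 1))))"
      by (simp add: power_mult_distrib flip: power_Suc)
    also have "3 * (d / r) * (unit_ball_vol ?n * (2 ^ ?n * (r * r ^ (?n - 1))))
        = tube_const ?n * d * r ^ (?n - 1)"
      using r by (simp add: tube_const_def)
    finally show "real (N + 1) * (unit_ball_vol ?n * (2 * r) ^ ?n) \<le> tube_const ?n * d * r ^ (?n - 1)" .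
  qed
  finally show ?thesis .
qed

lemma emeasure_tube_le:
  fixes y :: "'a::euclidean_space"
  assumes n: "2 \<le> DIM('a)" and r: "0 \<le> r" "r \<le> d" "0 < d" and v: "norm v \<le> d"
  shows "emeasure lborel (tube y r v) \<le> ennreal (tube_const DIM('a) * d * r ^ (DIM('a) - 1))"
proof (cases "r = 0")
  case True
  let ?f = "\<lambda>r. tube_const DIM('a) * d * r ^ (DIM('a) - 1)"
  have "(?f \<longlongrightarrow> ?f 0) (at_right 0)"
    by (intro tendsto_intros)
  then have "((\<lambda>r. ennreal (?f r)) \<longlongrightarrow> ennreal (?f 0)) (at_right 0)"
    by (rule tendsto_ennrealI)
  moreover have "\<forall>\<^sub>F r' in at_right 0. emeasure lborel (tube y r v) \<le> ennreal (?f r')"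
    using eventually_at_right_real[OF r(3)]
  proof eventually_elim
    case (elim r')
    then have "emeasure lborel (tube y r v) \<le> emeasure lborel (tube y r' v)"
      using True compact_tube by (intro emeasure_mono tube_mono) (auto intro: borel_compact)
    also have "\<dots> \<le> ennreal (?f r')"
      using elim v by (intro emeasure_tube_le_aux) auto
    finally show ?case .
  qed
  ultimately have "emeasure lborel (tube y r v) \<le> ennreal (?f 0)"
    by (intro tendsto_lowerbound) auto
  then show ?thesis using True by simp
next
  case False
  then show ?thesis using assms by (intro emeasure_tube_le_aux) auto
qed

text \<open>The last two factors convert \<open>diameter S ^ (n - 1)\<close> into the Hausdorff
  gauge of \<open>S\<close>.\<close>

definition crossing_const :: "nat \<Rightarrow> real" where
  "crossing_const n = tube_const n * 2 ^ (n - 1) / unit_ball_vol (real (n - 1))"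

lemma crossing_const_pos: "crossing_const n > 0"
  by (simp add: crossing_const_def tube_const_pos)

text \<open>By convexity the segment from \<open>x\<close> to \<open>x + v\<close> stays in
  \<open>D\<close>, so its crossing point lies in some \<open>S i\<close>. Then \<open>x\<close> is
  in the tube of radius \<open>diameter (S i)\<close> around any chosen point of \<open>S i\<close>,
  and the volumes of the tubes are summed.\<close>

lemma emeasure_crossing_le_cover:
  fixes \<Omega> D :: "'a::euclidean_space set"
  assumes n: "2 \<le> DIM('a)" and \<Omega>: "open \<Omega>" and D: "convex D" "D \<in> sets borel"
    and d: "0 < d" "norm v \<le> d"
    and S: "frontier \<Omega> \<inter> D \<subseteq> (\<Union>i. S i)" "\<And>i::nat. bounded (S i)" "\<And>i. diameter (S i) \<le> d"
  shows "emeasure lborel {x \<in> \<Omega> \<inter> D. x + v \<in> D - \<Omega>}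
    \<le> ennreal (crossing_const DIM('a) * d) * (\<Sum>i. hausdorff_gauge (DIM('a) - 1) (S i))"
proof -
  \<comment> \<open>An empty covering set has gauge 0 and offers no centre, so its tube is taken to
    be empty.\<close>
  define T where "T i = (if S i = {} then {} else tube (SOME y. y \<in> S i) (diameter (S i)) v)" for i
  have T_sets: "T i \<in> sets lborel" for i
    by (simp add: T_def compact_tube borel_compact)
  have "{x \<in> \<Omega> \<inter> D. x + v \<in> D - \<Omega>} \<subseteq> (\<Union>i. T i)"
  proof
    fix x assume "x \<in> {x \<in> \<Omega> \<inter> D. x + v \<in> D - \<Omega>}"
    then have x: "x \<in> \<Omega>" "x \<in> D" "x + v \<in> D" "x + v \<notin> \<Omega>" by auto
    have "closed_segment x (x + v) \<inter> frontier \<Omega> \<noteq> {}"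
      using x by (intro connected_Int_frontier) auto
    then obtain w where w: "w \<in> closed_segment x (x + v)" "w \<in> frontier \<Omega>" by auto
    then have "w \<in> D"
      using D(1) x closed_segment_subset by blast
    with w S obtain i where i: "w \<in> S i" by blast
    obtain t where t: "0 \<le> t" "t \<le> 1" "w = x + t *\<^sub>R v"
      using w by (auto simp: closed_segment_def algebra_simps)
    define y where "y = (SOME y. y \<in> S i)"
    have "y \<in> S i" unfolding y_def using i by (rule someI)
    then have "dist y w \<le> diameter (S i)"
      using S(2) i diameter_bounded_bound by blast
    then have "x \<in> T i"
      using i t by (auto simp: T_def tube_def y_def[symmetric] intro!: image_eqI[of _ _ "(t, w)"])
    then show "x \<in> (\<Union>i. T i)" by blast
  qed
  then have "emeasure lborel {x \<in> \<Omega> \<inter> D. x + v \<in> D - \<Omega>} \<le> emeasure lborel (\<Union>i. T i)"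
    using T_sets by (intro emeasure_mono) auto
  also have "\<dots> \<le> (\<Sum>i. emeasure lborel (T i))"
    using T_sets by (intro emeasure_subadditive_countably) auto
  also have "\<dots> \<le> (\<Sum>i. ennreal (crossing_const DIM('a) * d) * hausdorff_gauge (DIM('a) - 1) (S i))"
  proof (intro suminf_le summableI)
    fix i
    show "emeasure lborel (T i)
        \<le> ennreal (crossing_const DIM('a) * d) * hausdorff_gauge (DIM('a) - 1) (S i)"
    proof (cases "S i = {}")
      case False
      have "emeasure lborel (T i) \<le> ennreal (tube_const DIM('a) * d * diameter (S i) ^ (DIM('a) - 1))"
        unfolding T_def if_not_P[OF False]
        by (intro emeasure_tube_le n d S diameter_ge_0)
      also have "tube_const DIM('a) * d * diameter (S i) ^ (DIM('a) - 1) =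
          (crossing_const DIM('a) * d) *
          (unit_ball_vol (real (DIM('a) - 1)) * (diameter (S i) / 2) ^ (DIM('a) - 1))"
      proof -
        define w where "w = unit_ball_vol (real (DIM('a) - 1))"
        have "w > 0" unfolding w_def by simp
        then show ?thesis
          unfolding crossing_const_def power_divide w_def[symmetric] by simp
      qed
      finally show ?thesis
        using False d crossing_const_pos[of "DIM('a)"] by (simp add: hausdorff_gauge_def ennreal_mult')
    qed (simp add: T_def)
  qed
  finally show ?thesis by simp
qed

text \<open>Dividing by the constant turns the estimate for single coverings into a lower bound for
  their infimum. The premeasure at the scale \<open>d\<close> lies below
  \<open>hausdorff_outer\<close>, which is a supremum over scales.\<close>

lemma emeasure_crossing_le:
  fixes \<Omega> D :: "'a::euclidean_space set"
  assumes n: "2 \<le> DIM('a)" and \<Omega>: "open \<Omega>" and D: "convex D" "D \<in> sets borel"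
    and d: "0 < d" "norm v \<le> d"
  shows "emeasure lborel {x \<in> \<Omega> \<inter> D. x + v \<in> D - \<Omega>}
    \<le> ennreal (crossing_const DIM('a) * d) * hausdorff_outer (DIM('a) - 1) (frontier \<Omega> \<inter> D)"
proof -
  let ?g = "emeasure lborel {x \<in> \<Omega> \<inter> D. x + v \<in> D - \<Omega>}" and ?c = "crossing_const DIM('a) * d"
  have c: "?c > 0" using d crossing_const_pos[of "DIM('a)"] by simp
  have inv: "ennreal (1 / ?c) * (ennreal ?c * X) = X" "ennreal ?c * (ennreal (1 / ?c) * X) = X" for X
  proof -
    have "ennreal (1 / ?c) * ennreal ?c = ennreal (1 / ?c * ?c)"
      using c by (intro ennreal_mult[symmetric]) auto
    also have "1 / ?c * ?c = 1" using c by (simp only: times_divide_eq_left mult_1 divide_self_if split: if_splits) linarith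
    finally have *: "ennreal (1 / ?c) * ennreal ?c = 1" by simp
    show "ennreal (1 / ?c) * (ennreal ?c * X) = X" "ennreal ?c * (ennreal (1 / ?c) * X) = X"
      using * by (metis mult.assoc mult.commute mult_1)+
  qed
  have "ennreal (1 / ?c) * ?g \<le> hausdorff_premeasure (DIM('a) - 1) d (frontier \<Omega> \<inter> D)"
    unfolding hausdorff_premeasure_def
  proof (intro INF_greatest)
    fix S :: "nat \<Rightarrow> 'a set"
    assume "S \<in> {S. frontier \<Omega> \<inter> D \<subseteq> (\<Union>i. S i) \<and> (\<forall>i. bounded (S i) \<and> diameter (S i) \<le> d)}"
    then have "?g \<le> ennreal ?c * (\<Sum>i. hausdorff_gauge (DIM('a) - 1) (S i))"
      using assms by (intro emeasure_crossing_le_cover) auto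
    then have "ennreal (1 / ?c) * ?g
        \<le> ennreal (1 / ?c) * (ennreal ?c * (\<Sum>i. hausdorff_gauge (DIM('a) - 1) (S i)))"
      by (rule mult_left_mono) simp
    then show "ennreal (1 / ?c) * ?g \<le> (\<Sum>i. hausdorff_gauge (DIM('a) - 1) (S i))"
      by (simp only: inv)
  qed
  also have "\<dots> \<le> hausdorff_outer (DIM('a) - 1) (frontier \<Omega> \<inter> D)"
    unfolding hausdorff_outer_def using d by (intro SUP_upper) auto
  finally have "ennreal ?c * (ennreal (1 / ?c) * ?g)
      \<le> ennreal ?c * hausdorff_outer (DIM('a) - 1) (frontier \<Omega> \<inter> D)"
    by (rule mult_left_mono) simp
  then show ?thesis by (simp only: inv)
qed

definition isop_const :: "nat \<Rightarrow> real" where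
  "isop_const n = crossing_const n * unit_ball_vol (real n)"

lemma isop_const_pos: "isop_const n > 0"
  by (simp add: isop_const_def crossing_const_pos)

text \<open>The product of volumes is the double integral of the indicator of \<open>x\<close> in
  the first set and \<open>x + v\<close> in the second. After exchanging the integrals, each
  \<open>v\<close> contributes a crossing volume of order \<open>d\<close>; only \<open>v\<close> in
  \<open>cball 0 d\<close> contribute, which gives the further factor \<open>d ^ n\<close>.\<close>

lemma relative_isoperimetric_inequality:
  fixes \<Omega> D :: "'a::euclidean_space set"
  assumes n: "2 \<le> DIM('a)" and \<Omega>: "open \<Omega>" and D: "convex D" "D \<in> sets borel"
    and d: "0 < d" "\<And>x y. x \<in> D \<Longrightarrow> y \<in> D \<Longrightarrow> dist x y \<le> d"
  shows "emeasure lborel (\<Omega> \<inter> D) * emeasure lborel (D - \<Omega>)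
    \<le> ennreal (isop_const DIM('a) * d ^ (DIM('a) + 1))
      * hausdorff_outer (DIM('a) - 1) (frontier \<Omega> \<inter> D)"
proof -
  let ?E = "\<Omega> \<inter> D" and ?F = "D - \<Omega>"
  let ?H = "hausdorff_outer (DIM('a) - 1) (frontier \<Omega> \<inter> D)" and ?c = "crossing_const DIM('a) * d"
  have [measurable]: "?E \<in> sets borel" "?F \<in> sets borel"
    using \<Omega> D by auto
  have inner: "(\<integral>\<^sup>+v. indicator ?E x * indicator ?F (x + v) \<partial>lborel)
      = indicator ?E x * emeasure lborel ?F" for x
  proof -
    have "(\<integral>\<^sup>+v. indicator ?F (x + v) \<partial>lborel) = (\<integral>\<^sup>+v. indicator ?F v \<partial>distr lborel borel ((+) x))"
      by (subst nn_integral_distr) auto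
    also have "\<dots> = emeasure lborel ?F"
      by (simp add: lborel_distr_plus)
    finally show ?thesis
      by (simp add: nn_integral_cmult)
  qed
  have "emeasure lborel ?E * emeasure lborel ?F
      = (\<integral>\<^sup>+x. indicator ?E x * emeasure lborel ?F \<partial>lborel)"
    by (simp add: nn_integral_multc)
  also have "\<dots> = (\<integral>\<^sup>+x. \<integral>\<^sup>+v. indicator ?E x * indicator ?F (x + v) \<partial>lborel \<partial>lborel)"
    by (simp add: inner)
  also have "\<dots> = (\<integral>\<^sup>+v. \<integral>\<^sup>+x. indicator ?E x * indicator ?F (x + v) \<partial>lborel \<partial>lborel)"
    by (rule lborel_pair.Fubini') measurable
  also have "\<dots> \<le> (\<integral>\<^sup>+v. (ennreal ?c * ?H) * indicator (cball (0 :: 'a) d) v \<partial>lborel)"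
  proof (rule nn_integral_mono)
    fix v :: 'a
    have "(\<integral>\<^sup>+x. indicator ?E x * indicator ?F (x + v) \<partial>lborel)
        = (\<integral>\<^sup>+x. indicator {x \<in> ?E. x + v \<in> ?F} x \<partial>lborel)"
      by (intro nn_integral_cong) (auto simp: indicator_def)
    also have "\<dots> = emeasure lborel {x \<in> ?E. x + v \<in> ?F}"
      by (rule nn_integral_indicator) measurable
    also have "\<dots> \<le> (ennreal ?c * ?H) * indicator (cball (0 :: 'a) d) v"
    proof (cases "norm v \<le> d")
      case True
      then show ?thesis
        using emeasure_crossing_le[OF n \<Omega> D d(1) True] by simp
    next
      case False
      have "dist x (x + v) = norm v" for x by (simp add: dist_norm)
      then have "{x \<in> ?E. x + v \<in> ?F} = {}"
        using d(2) False by (metis (mono_tags, lifting) Collect_empty_eq DiffD1 IntD2)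
      then show ?thesis by (simp only: emeasure_empty zero_le)
    qed
    finally show "(\<integral>\<^sup>+x. indicator ?E x * indicator ?F (x + v) \<partial>lborel)
      \<le> (ennreal ?c * ?H) * indicator (cball (0 :: 'a) d) v" .
  qed
  also have "\<dots> = (ennreal ?c * ?H) * ennreal (unit_ball_vol DIM('a) * d ^ DIM('a))"
    using d by (subst nn_integral_cmult_indicator) (auto simp: emeasure_cball)
  also have "\<dots> = ennreal (?c * (unit_ball_vol DIM('a) * d ^ DIM('a))) * ?H"
    using d crossing_const_pos[of "DIM('a)"] by (simp add: ennreal_mult mult_ac)
  also have "?c * (unit_ball_vol DIM('a) * d ^ DIM('a)) = isop_const DIM('a) * d ^ (DIM('a) + 1)"
    by (simp add: isop_const_def)
  finally show ?thesis .
qed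

section \<open>The integer lattice\<close>

lemma vec_Pi_eq_image: "{z :: 'a^'n. \<forall>i. z $ i \<in> A} = vec_lambda ` (UNIV \<rightarrow>\<^sub>E A)"
proof (intro equalityI subsetI)
  fix z :: "'a^'n" assume "z \<in> {z. \<forall>i. z $ i \<in> A}"
  then show "z \<in> vec_lambda ` (UNIV \<rightarrow>\<^sub>E A)"
    by (intro image_eqI[of _ _ "($) z"]) auto
qed auto

lemma finite_vec_Pi: "finite A \<Longrightarrow> finite {z :: 'a^'n. \<forall>i. z $ i \<in> A}"
  unfolding vec_Pi_eq_image by (intro finite_imageI finite_PiE) auto

lemma card_vec_Pi: "card {z :: 'a^'n. \<forall>i. z $ i \<in> A} = card A ^ CARD('n)"
proof -
  have "inj_on vec_lambda (UNIV \<rightarrow>\<^sub>E A :: ('n \<Rightarrow> 'a) set)"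
    by (intro inj_onI) (simp add: vec_lambda_inject)
  then show ?thesis
    unfolding vec_Pi_eq_image by (simp add: card_image card_PiE)
qed

text \<open>Only steps in positive axis directions are tested; this suffices for translations by
  vectors with nonnegative entries, which are sums of such steps.\<close>

definition inner_boundary :: "(int^'n) set \<Rightarrow> (int^'n) set" where
  "inner_boundary F = {z \<in> F. \<exists>i. z + axis i 1 \<notin> F}"

text \<open>Some translate of \<open>F\<close> by a vector of the box \<open>[0, l)\<^sup>n\<close> moves half of \<open>F\<close> off itself,
  because on average over the box at most \<open>(card F)\<^sup>2 / l\<^sup>n\<close> points stay in \<open>F\<close>.\<close>

lemma discrete_isoperimetric_inequality:
  fixes F :: "(int^'n) set"
  assumes F: "finite F" and l: "2 * card F \<le> l ^ CARD('n)"
  shows "card F \<le> 2 * CARD('n) * l * card (inner_boundary F)"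
proof (cases "F = {}")
  case False
  \<comment> \<open>The number of points that a translation moves out of \<open>F\<close> is
    subadditive in the translation: a point lost under \<open>v + w\<close> is lost under
    \<open>v\<close>, or its image under \<open>v\<close> is lost under \<open>w\<close>.\<close>
  define d where "d v = card {z \<in> F. z + v \<notin> F}" for v
  define b where "b = card (inner_boundary F)"
  have d0: "d 0 = 0" by (simp add: d_def)
  have d_add: "d (v + w) \<le> d v + d w" for v w
  proof -
    have "{z \<in> F. z + (v + w) \<notin> F}
        \<subseteq> {z \<in> F. z + v \<notin> F} \<union> (\<lambda>z. z - v) ` {z \<in> F. z + w \<notin> F}"
    proof
      fix z assume z: "z \<in> {z \<in> F. z + (v + w) \<notin> F}"
      show "z \<in> {z \<in> F. z + v \<notin> F} \<union> (\<lambda>z. z - v) ` {z \<in> F. z + w \<notin> F}"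
      proof (cases "z + v \<in> F")
        case True
        then have "z + v \<in> {z \<in> F. z + w \<notin> F}" using z by (simp add: add.assoc)
        then have "(z + v) - v \<in> (\<lambda>z. z - v) ` {z \<in> F. z + w \<notin> F}" by (rule imageI)
        then show ?thesis by simp
      qed (use z in simp)
    qed
    then have "d (v + w) \<le> card ({z \<in> F. z + v \<notin> F} \<union> (\<lambda>z. z - v) ` {z \<in> F. z + w \<notin> F})"
      unfolding d_def using F by (intro card_mono) auto
    also have "\<dots> \<le> d v + card ((\<lambda>z. z - v) ` {z \<in> F. z + w \<notin> F})"
      unfolding d_def by (rule card_Un_le)
    also have "\<dots> \<le> d v + d w"
      unfolding d_def using F by (intro add_left_mono card_image_le) auto
    finally show ?thesis .
  qed
  have d_axis: "d (axis i (int m)) \<le> m * b" for i m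
  proof (induction m)
    case 0
    have "axis i (int 0) = 0" by (simp add: axis_def vec_eq_iff)
    then show ?case by (simp only: d0 mult_0)
  next
    case (Suc m)
    have "axis i (int (Suc m)) = axis i (int m) + axis i 1"
      by (simp add: axis_def vec_eq_iff)
    then have "d (axis i (int (Suc m))) \<le> d (axis i (int m)) + d (axis i 1)"
      using d_add by simp
    moreover have "d (axis i 1) \<le> b"
      unfolding d_def b_def using F by (intro card_mono) (auto simp: inner_boundary_def)
    ultimately show ?case using Suc by simp
  qed
  define Box where "Box = {v :: int^'n. \<forall>i. v $ i \<in> {0..<int l}}"
  have Box: "finite Box" "card Box = l ^ CARD('n)"
    unfolding Box_def by (simp_all only: finite_vec_Pi card_vec_Pi finite_atLeastLessThan_int card_atLeastLessThan_int) simp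
  have d_Box: "d v \<le> CARD('n) * l * b" if "v \<in> Box" for v
  proof -
    have "d (\<Sum>i\<in>I. axis i (v $ i)) \<le> card I * (l * b)" if "finite I" for I
      using that
    proof induction
      case (insert i I)
      have "d (axis i (v $ i)) \<le> l * b"
      proof -
        have vi: "0 \<le> v $ i" "v $ i < int l" using \<open>v \<in> Box\<close> by (auto simp: Box_def)
        then have "d (axis i (int (nat (v $ i)))) \<le> nat (v $ i) * b" by (intro d_axis)
        also have "\<dots> \<le> l * b" using vi by (intro mult_right_mono) auto
        finally show ?thesis using vi by simp
      qed
      then show ?case
        using insert d_add[of "axis i (v $ i)" "\<Sum>i\<in>I. axis i (v $ i)"] by simp
    qed (simp add: d0)
    from this[of UNIV] have "d (\<Sum>i\<in>UNIV. axis i (v $ i)) \<le> CARD('n) * (l * b)" by simp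
    moreover have "(\<Sum>i\<in>UNIV. axis i (v $ i)) = v"
      by (simp add: vec_eq_iff axis_def)
    ultimately show ?thesis by (simp add: mult.assoc)
  qed
  have stay: "card {z \<in> F. z + v \<in> F} + d v = card F" for v
  proof -
    have "card ({z \<in> F. z + v \<in> F} \<union> {z \<in> F. z + v \<notin> F})
        = card {z \<in> F. z + v \<in> F} + card {z \<in> F. z + v \<notin> F}"
      using F by (intro card_Un_disjoint) auto
    moreover have "{z \<in> F. z + v \<in> F} \<union> {z \<in> F. z + v \<notin> F} = F" by auto
    ultimately show ?thesis by (simp add: d_def)
  qed
  \<comment> \<open>Double counting: a fixed \<open>z\<close> reaches each point of \<open>F\<close>
    by at most one translation.\<close>
  have "(\<Sum>v\<in>Box. card {z \<in> F. z + v \<in> F}) = (\<Sum>z\<in>F. card {v \<in> Box. z + v \<in> F})"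
    by (intro sum_multicount_gen) (use F Box in auto)
  also have "\<dots> \<le> (\<Sum>z\<in>F. card F)"
  proof (intro sum_mono)
    fix z
    show "card {v \<in> Box. z + v \<in> F} \<le> card F"
      using F by (intro card_inj_on_le[of "(+) z"]) auto
  qed
  also have "\<dots> = card F * card F" by simp
  finally have "(\<Sum>v\<in>Box. card {z \<in> F. z + v \<in> F}) \<le> card F * card F" .
  moreover have "(\<Sum>v\<in>Box. card F) \<le> (\<Sum>v\<in>Box. card {z \<in> F. z + v \<in> F} + CARD('n) * l * b)"
  proof (rule sum_mono)
    fix v assume "v \<in> Box"
    then show "card F \<le> card {z \<in> F. z + v \<in> F} + CARD('n) * l * b"
      using d_Box[of v] stay[of v] by linarith
  qed
  ultimately have "l ^ CARD('n) * card F \<le> card F * card F + l ^ CARD('n) * (CARD('n) * l * b)"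
    by (simp add: sum.distrib Box)
  \<comment> \<open>The hypothesis on \<open>l\<close> absorbs the quadratic term into half of the
    left-hand side.\<close>
  moreover have "2 * (card F * card F) \<le> l ^ CARD('n) * card F"
    using mult_right_mono[OF l, of "card F"] by (simp add: mult.assoc)
  ultimately have "l ^ CARD('n) * card F \<le> 2 * (l ^ CARD('n) * (CARD('n) * l * b))"
    by linarith
  then have "l ^ CARD('n) * card F \<le> l ^ CARD('n) * (2 * CARD('n) * l * b)"
    by (simp only: mult_ac)
  moreover have "l ^ CARD('n) > 0"
  proof -
    have "card F > 0" using F False by (simp add: card_gt_0_iff)
    then show ?thesis using l by linarith
  qed
  ultimately show ?thesis by (simp add: b_def)
qed simp

text \<open>Pigeonhole on the \<open>m ^ n\<close> classes of coordinatewise residues mod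
  \<open>m\<close>: two distinct points of one class differ in some coordinate by a nonzero multiple
  of \<open>m\<close>.\<close>

lemma exists_separated_subset:
  fixes G :: "(int^'n) set"
  assumes G: "finite G" "m ^ CARD('n) * k \<le> card G" and m: "m > 0"
  shows "\<exists>G'\<subseteq>G. card G' = k \<and> (\<forall>z\<in>G'. \<forall>z'\<in>G'. z \<noteq> z' \<longrightarrow> (\<exists>i. int m \<le> \<bar>z $ i - z' $ i\<bar>))"
proof (cases "k = 0")
  case False
  define col where "col z = (\<chi> i. z $ i mod int m)" for z :: "int^'n"
  define W where "W = {w :: int^'n. \<forall>i. w $ i \<in> {0..<int m}}"
  have W: "finite W" "card W = m ^ CARD('n)"
    unfolding W_def by (simp_all only: finite_vec_Pi card_vec_Pi finite_atLeastLessThan_int card_atLeastLessThan_int) simp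
  have colW: "col z \<in> W" for z using m by (simp add: col_def W_def)
  have "\<exists>w. k \<le> card {z \<in> G. col z = w}"
  proof (rule ccontr)
    assume "\<nexists>w. k \<le> card {z \<in> G. col z = w}"
    then have small: "card {z \<in> G. col z = w} \<le> k - 1" for w
      by (metis Suc_pred' False bot_nat_0.not_eq_extremum not_less_eq_eq)
    have "card G \<le> card (\<Union>w\<in>W. {z \<in> G. col z = w})"
      using G W colW by (intro card_mono) auto
    also have "\<dots> \<le> (\<Sum>w\<in>W. card {z \<in> G. col z = w})"
      using W by (intro card_UN_le)
    also have "\<dots> \<le> card W * (k - 1)"
      using sum_bounded_above[of W "\<lambda>w. card {z \<in> G. col z = w}" "k - 1"] small by simp
    also have "\<dots> < m ^ CARD('n) * k"
      unfolding W(2) using m False by (intro mult_strict_left_mono) auto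
    finally show False using G(2) by linarith
  qed
  then obtain w where w: "k \<le> card {z \<in> G. col z = w}" ..
  obtain G' where G': "G' \<subseteq> {z \<in> G. col z = w}" "card G' = k"
    using obtain_subset_with_card_n[OF w] by metis
  have "\<exists>i. int m \<le> \<bar>z $ i - z' $ i\<bar>" if zz: "z \<in> G'" "z' \<in> G'" "z \<noteq> z'" for z z'
  proof -
    obtain i where i: "z $ i \<noteq> z' $ i" using zz(3) by (auto simp: vec_eq_iff)
    have "col z = col z'" using zz G' by auto
    then have "z $ i mod int m = z' $ i mod int m"
      by (simp add: col_def vec_eq_iff)
    then have "int m dvd \<bar>z $ i - z' $ i\<bar>" by (simp only: mod_eq_dvd_iff dvd_abs_iff)
    then have "int m \<le> \<bar>z $ i - z' $ i\<bar>" using i by (intro zdvd_imp_le) simp_all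
    then show ?thesis by blast
  qed
  then show ?thesis using G' by blast
qed (auto intro!: exI[of _ "{}"])

text \<open>Half-open, so that the cells partition space.\<close>

definition cell :: "real \<Rightarrow> int^'n \<Rightarrow> (real^'n) set" where
  "cell s z = {x. \<forall>i. s * real_of_int (z $ i) \<le> x $ i \<and> x $ i < s * (real_of_int (z $ i) + 1)}"

definition node :: "real \<Rightarrow> int^'n \<Rightarrow> real^'n" where
  "node s z = (\<chi> i. s * real_of_int (z $ i))"

section \<open>The partition of space into cubes\<close>

lemma mem_cell_iff: "s > 0 \<Longrightarrow> x \<in> cell s z \<longleftrightarrow> (\<forall>i. \<lfloor>x $ i / s\<rfloor> = z $ i)"
  by (simp add: cell_def floor_eq_iff pos_le_divide_eq pos_divide_less_eq mult.commute)

lemma mem_cell_floor: "s > 0 \<Longrightarrow> x \<in> cell s (\<chi> i. \<lfloor>x $ i / s\<rfloor>)"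
  by (simp add: mem_cell_iff)

lemma disjoint_cell: "s > 0 \<Longrightarrow> z \<noteq> z' \<Longrightarrow> cell s z \<inter> cell s z' = {}"
  by (auto simp: mem_cell_iff vec_eq_iff)

lemma cell_borel [measurable]: "cell s z \<in> sets borel"
  unfolding cell_def by measurable

text \<open>The cell lies between an open and a closed box of the same volume.\<close>

lemma emeasure_cell:
  assumes "s > 0"
  shows "emeasure lborel (cell s (z :: int^'n)) = ennreal (s ^ CARD('n))"
proof -
  let ?u = "(\<chi> i. s * (real_of_int (z $ i) + 1)) :: real^'n"
  have diff: "(?u - node s z) \<bullet> b = s" if "b \<in> Basis" for b
    using that by (auto simp: Basis_vec_def inner_axis node_def algebra_simps)
  then have le: "\<forall>b\<in>Basis. node s z \<bullet> b \<le> ?u \<bullet> b"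
    using assms by (metis diff_ge_0_iff_ge inner_diff_left less_imp_le)
  have "box (node s z) ?u \<subseteq> cell s z" "cell s z \<subseteq> cbox (node s z) ?u"
    by (auto simp: cell_def node_def mem_box_cart less_imp_le)
  moreover have "emeasure lborel (box (node s z) ?u) = ennreal (s ^ CARD('n))"
    "emeasure lborel (cbox (node s z) ?u) = ennreal (s ^ CARD('n))"
    using diff le assms by (simp_all add: emeasure_lborel_box_eq emeasure_lborel_cbox_eq prod_ennreal)
  ultimately show ?thesis
    by (metis antisym cell_borel emeasure_mono sets_lborel cbox_borel)
qed

section \<open>Nodes with small Rayleigh quotient\<close>

text \<open>The radius is large enough for the cell of \<open>z\<close> and its neighbours in the
  positive axis directions: their points differ from the corner \<open>node s z\<close> by at most
  \<open>2 s\<close> in each coordinate, hence by less than \<open>3 n s\<close> in norm.\<close>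

definition inner_ball :: "real \<Rightarrow> int^'n \<Rightarrow> (real^'n) set" where
  "inner_ball s z = ball (node s z) (3 * real CARD('n) * s)"

text \<open>Twice the inner radius, so that a bump supported here is bounded below on the inner
  ball.\<close>

definition outer_ball :: "real \<Rightarrow> int^'n \<Rightarrow> (real^'n) set" where
  "outer_ball s z = ball (node s z) (6 * real CARD('n) * s)"

text \<open>Together with the relative isoperimetric inequality in the inner ball, this bounds the energy of a bump
  function supported in the outer ball by its boundary mass in the inner ball.\<close>

definition good_node :: "(real^'n) set \<Rightarrow> real \<Rightarrow> real \<Rightarrow> int^'n \<Rightarrow> bool" where
  "good_node \<Omega> s K z \<longleftrightarrow>
     0 < measure lborel (\<Omega> \<inter> outer_ball s z) \<and>
     measure lborel (\<Omega> \<inter> outer_ball s z) * s ^ CARD('n)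
       \<le> K * (measure lborel (\<Omega> \<inter> inner_ball s z) * measure lborel (inner_ball s z - \<Omega>))"

lemma inner_subset_outer_ball: "s > 0 \<Longrightarrow> inner_ball s z \<subseteq> outer_ball s z"
  unfolding inner_ball_def outer_ball_def by (intro subset_ball) auto

lemma mem_inner_ballI:
  fixes x :: "real^'n"
  assumes "s > 0" "\<And>i. \<bar>x $ i - s * real_of_int (z $ i)\<bar> \<le> 2 * s"
  shows "x \<in> inner_ball s z"
proof -
  have "norm (node s z - x) \<le> (\<Sum>i\<in>UNIV. \<bar>(node s z - x) $ i\<bar>)"
    by (rule norm_le_l1_cart)
  also have "\<dots> \<le> (\<Sum>i\<in>(UNIV :: 'n set). 2 * s)"
    using assms(2) by (intro sum_mono) (simp add: node_def abs_minus_commute)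
  also have "\<dots> < 3 * real CARD('n) * s"
    using assms(1) by simp
  finally show ?thesis by (simp add: inner_ball_def dist_norm)
qed

lemma cell_subset_inner_ball: "s > 0 \<Longrightarrow> cell s z \<subseteq> inner_ball s z"
proof (intro subsetI mem_inner_ballI)
  fix x and i
  assume s: "s > 0" and "x \<in> cell s z"
  then have "s * real_of_int (z $ i) \<le> x $ i" "x $ i < s * real_of_int (z $ i) + s"
    by (auto simp: cell_def algebra_simps)
  then show "\<bar>x $ i - s * real_of_int (z $ i)\<bar> \<le> 2 * s"
    using s by linarith
qed

lemma neighbour_cell_subset_inner_ball:
  assumes "s > 0"
  shows "cell s (z + axis j 1) \<subseteq> inner_ball s z"
proof (intro subsetI mem_inner_ballI assms)
  fix x and i
  assume "x \<in> cell s (z + axis j 1)"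
  then have "s * (real_of_int (z $ i) + (if i = j then 1 else 0)) \<le> x $ i"
    "x $ i < s * (real_of_int (z $ i) + (if i = j then 1 else 0) + 1)"
    by (auto simp: cell_def axis_def dest!: spec[of _ i])
  then show "\<bar>x $ i - s * real_of_int (z $ i)\<bar> \<le> 2 * s"
    using assms by (auto simp: algebra_simps abs_le_iff split: if_splits)
qed

text \<open>After division by \<open>s\<close> the coordinates of \<open>x\<close> and of the centre
  differ by less than \<open>6 n\<close>, and taking floors costs at most 1.\<close>

lemma outer_ball_subset_cells:
  fixes z :: "int^'n"
  assumes s: "s > 0"
  shows "outer_ball s z
    \<subseteq> (\<Union>w\<in>{w. \<forall>i. w $ i \<in> {- int (6 * CARD('n) + 1)..int (6 * CARD('n) + 1)}}. cell s (z + w))"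
proof
  fix x :: "real^'n" assume x: "x \<in> outer_ball s z"
  define w where "w = (\<chi> i. \<lfloor>x $ i / s\<rfloor>) - z"
  have "w $ i \<in> {- int (6 * CARD('n) + 1)..int (6 * CARD('n) + 1)}" for i
  proof -
    have "\<bar>x $ i - s * real_of_int (z $ i)\<bar> \<le> norm (x - node s z)"
      using component_le_norm_cart[of "x - node s z" i] by (simp add: node_def)
    also have "\<dots> < 6 * real CARD('n) * s"
      using x by (simp add: outer_ball_def dist_norm norm_minus_commute)
    finally have "\<bar>x $ i / s - real_of_int (z $ i)\<bar> * s < (6 * real CARD('n)) * s"
      using s by (simp add: abs_if field_simps split: if_splits)
    then have "\<bar>x $ i / s - real_of_int (z $ i)\<bar> < 6 * real CARD('n)"
      using s by (simp only: mult_less_cancel_right_pos)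
    then have "\<bar>\<lfloor>x $ i / s\<rfloor> - z $ i\<bar> \<le> int (6 * CARD('n) + 1)"
      by linarith
    then show ?thesis by (simp add: w_def abs_le_iff)
  qed
  moreover have "x \<in> cell s (z + w)"
    using mem_cell_floor[OF s, of x] by (simp add: w_def)
  ultimately show "x \<in> (\<Union>w\<in>{w. \<forall>i. w $ i \<in> {- int (6 * CARD('n) + 1)..int (6 * CARD('n) + 1)}}. cell s (z + w))"
    by blast
qed

text \<open>Their number depends on the dimension alone; it bounds the cells needed to cover an
  outer ball and thereby the overlap of the outer balls in the averaging argument.\<close>

definition offsets :: "(int^'n) set" where
  "offsets = {w. \<forall>i. w $ i \<in> {- int (6 * CARD('n) + 1)..int (6 * CARD('n) + 1)}}"

lemma finite_offsets: "finite (offsets :: (int^'n) set)"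
  unfolding offsets_def by (intro finite_vec_Pi) simp

lemma offsets_nonempty: "card (offsets :: (int^'n) set) > 0"
proof -
  have "(0 :: int^'n) \<in> offsets" by (simp add: offsets_def)
  then show ?thesis using finite_offsets by (auto simp: card_gt_0_iff)
qed

text \<open>The two summands are the constants of the thin and the thick case, so the sum serves
  both.\<close>

definition good_const :: "'n::finite itself \<Rightarrow> real" where
  "good_const _ = 8 * real (card (offsets :: (int^'n) set)) + 4 * unit_ball_vol (real CARD('n)) * (6 * real CARD('n)) ^ CARD('n)"

section \<open>Counting good nodes at a fixed scale\<close>

context
  fixes \<Omega> :: "(real^'n) set" and s :: real
  assumes \<Omega>: "open \<Omega>" "bounded \<Omega>" and s: "s > 0"
begin

definition mass :: "int^'n \<Rightarrow> real" where "mass z = measure lborel (\<Omega> \<inter> cell s z)"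
definition Cells :: "(int^'n) set" where "Cells = {z. \<Omega> \<inter> cell s z \<noteq> {}}"

lemma fmeasurable_Int_Omega: "A \<in> sets borel \<Longrightarrow> \<Omega> \<inter> A \<in> fmeasurable lborel"
proof -
  assume A: "A \<in> sets borel"
  have "\<Omega> \<in> fmeasurable lborel"
    using \<Omega> emeasure_bounded_finite[OF \<Omega>(2)] by (intro fmeasurableI) auto
  then show ?thesis
    using A by (intro fmeasurable_Int_fmeasurable) auto
qed

lemma finite_Cells: "finite Cells"
proof -
  obtain B where B: "\<And>x. x \<in> \<Omega> \<Longrightarrow> norm x \<le> B"
    using \<Omega>(2) bounded_iff by metis
  have "Cells \<subseteq> {z. \<forall>i. z $ i \<in> {\<lfloor>- B / s\<rfloor>..\<lfloor>B / s\<rfloor>}}"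
  proof (intro subsetI CollectI allI)
    fix z :: "int^'n" and i assume "z \<in> Cells"
    then obtain x where x: "x \<in> \<Omega>" "x \<in> cell s z" by (auto simp: Cells_def)
    have "\<bar>x $ i\<bar> \<le> B" using B[OF x(1)] component_le_norm_cart[of x i] by linarith
    then have "- B / s \<le> x $ i / s" "x $ i / s \<le> B / s"
      using s by (intro divide_right_mono; simp add: abs_le_iff)+
    moreover have "z $ i = \<lfloor>x $ i / s\<rfloor>"
      using x(2) mem_cell_iff[OF s] by metis
    ultimately show "z $ i \<in> {\<lfloor>- B / s\<rfloor>..\<lfloor>B / s\<rfloor>}"
      by (simp add: floor_mono)
  qed
  then show ?thesis
    by (rule finite_subset) (intro finite_vec_Pi finite_atLeastAtMost_int)
qed

lemma mass_nonneg: "mass z \<ge> 0"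
  by (simp add: mass_def)

lemma mass_outside: "z \<notin> Cells \<Longrightarrow> mass z = 0"
  by (simp add: Cells_def mass_def)

lemma measure_cell: "measure lborel (cell s z) = s ^ CARD('n)" for z :: "int^'n"
  using emeasure_cell[OF s, of z] s by (simp add: measure_def)

lemma fmeasurable_cell: "cell s z \<in> fmeasurable lborel" for z :: "int^'n"
  using emeasure_cell[OF s, of z] by (intro fmeasurableI) auto

lemma mass_le: "mass z \<le> s ^ CARD('n)"
  unfolding mass_def measure_cell[of z, symmetric]
  by (intro measure_mono_fmeasurable) (use \<Omega> fmeasurable_cell in auto)

lemma sum_mass: "finite Z \<Longrightarrow> (\<Sum>z\<in>Z. mass z) = measure lborel (\<Union>z\<in>Z. \<Omega> \<inter> cell s z)"
  unfolding mass_def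
proof (rule measure_finite_Union[symmetric])
  show "disjoint_family_on (\<lambda>z. \<Omega> \<inter> cell s z) Z"
    using disjoint_cell[OF s] by (auto simp: disjoint_family_on_def)
  show "emeasure lborel (\<Omega> \<inter> cell s z) \<noteq> \<infinity>" for z
    using fmeasurable_Int_Omega[of "cell s z"] by (auto simp: fmeasurable_def)
qed (use \<Omega> in auto)

lemma sum_mass_Cells: "(\<Sum>z\<in>Cells. mass z) = measure lborel \<Omega>"
proof -
  have "(\<Union>z\<in>Cells. \<Omega> \<inter> cell s z) = \<Omega>"
    using mem_cell_floor[OF s] by (auto simp: Cells_def)
  then show ?thesis using sum_mass[OF finite_Cells] by simp
qed

lemma sum_mass_le: "finite Z \<Longrightarrow> (\<Sum>z\<in>Z. mass z) \<le> measure lborel \<Omega>"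
  using fmeasurable_Int_Omega[of UNIV] \<Omega>
  by (subst sum_mass) (auto intro!: measure_mono_fmeasurable)

lemma outer_le_sum_mass: "measure lborel (\<Omega> \<inter> outer_ball s z) \<le> (\<Sum>w\<in>offsets. mass (z + w))"
proof -
  have "measure lborel (\<Omega> \<inter> outer_ball s z) \<le> measure lborel (\<Union>w\<in>offsets. \<Omega> \<inter> cell s (z + w))"
    using outer_ball_subset_cells[OF s, of z] finite_offsets \<Omega>
    by (intro measure_mono_fmeasurable fmeasurable.finite_UN fmeasurable_Int_Omega)
      (auto simp: offsets_def outer_ball_def)
  also have "\<dots> \<le> (\<Sum>w\<in>offsets. measure lborel (\<Omega> \<inter> cell s (z + w)))"
    using finite_offsets by (intro measure_UNION_le) (use \<Omega> in auto)
  finally show ?thesis by (simp add: mass_def)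
qed

lemma mass_le_inner: "mass z \<le> measure lborel (\<Omega> \<inter> inner_ball s z)"
  unfolding mass_def using cell_subset_inner_ball[OF s, of z] \<Omega>
  by (intro measure_mono_fmeasurable fmeasurable_Int_Omega) (auto simp: inner_ball_def)

lemma mass_le_outer: "mass z \<le> measure lborel (\<Omega> \<inter> outer_ball s z)"
  unfolding mass_def using cell_subset_inner_ball[OF s, of z] inner_subset_outer_ball[OF s, of z] \<Omega>
  by (intro measure_mono_fmeasurable fmeasurable_Int_Omega) (auto simp: outer_ball_def)

lemma complement_le_inner:
  assumes "cell s w \<subseteq> inner_ball s z"
  shows "s ^ CARD('n) - mass w \<le> measure lborel (inner_ball s z - \<Omega>)"
proof -
  have "measure lborel (cell s w - cell s w \<inter> \<Omega>)
      = measure lborel (cell s w) - measure lborel (cell s w \<inter> \<Omega>)"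
    using fmeasurable_cell \<Omega> by (intro measurable_measure_Diff) auto
  moreover have "cell s w - cell s w \<inter> \<Omega> = cell s w - \<Omega>" by blast
  ultimately have "s ^ CARD('n) - mass w = measure lborel (cell s w - \<Omega>)"
    by (simp add: measure_cell mass_def Int_commute)
  also have "\<dots> \<le> measure lborel (inner_ball s z - \<Omega>)"
  proof (intro measure_mono_fmeasurable)
    show "inner_ball s z - \<Omega> \<in> fmeasurable lborel"
      using \<Omega> by (intro fmeasurableI emeasure_bounded_finite) (auto simp: inner_ball_def intro: bounded_subset[OF bounded_ball])
  qed (use assms \<Omega> in auto)
  finally show ?thesis .
qed

text \<open>The cell itself supplies both factors: at least half of it lies outside
  \<open>\<Omega>\<close>, and its mass, a lower bound for the inner volume, controls the outer
  volume by assumption.\<close>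

lemma good_nodeI_thin:
  assumes z: "0 < mass z" "mass z \<le> s ^ CARD('n) / 2"
    and outer: "measure lborel (\<Omega> \<inter> outer_ball s z) \<le> 4 * real (card (offsets :: (int^'n) set)) * mass z"
  shows "good_node \<Omega> s (good_const TYPE('n)) z"
proof -
  let ?I = "measure lborel (\<Omega> \<inter> inner_ball s z)" and ?J = "measure lborel (inner_ball s z - \<Omega>)"
  let ?c = "real (card (offsets :: (int^'n) set))"
  have J: "s ^ CARD('n) / 2 \<le> ?J"
    using complement_le_inner[OF cell_subset_inner_ball[OF s, of z]] z(2) by linarith
  have "measure lborel (\<Omega> \<inter> outer_ball s z) * s ^ CARD('n) \<le> (4 * ?c * ?I) * (2 * ?J)"
  proof (intro mult_mono)
    show "measure lborel (\<Omega> \<inter> outer_ball s z) \<le> 4 * ?c * ?I"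
      using outer mult_left_mono[OF mass_le_inner[of z], of "4 * ?c"] by linarith
  qed (use J s in auto)
  also have "\<dots> = 8 * ?c * (?I * ?J)" by simp
  also have "\<dots> \<le> good_const TYPE('n) * (?I * ?J)"
    by (intro mult_right_mono) (auto simp: good_const_def)
  finally show ?thesis
    unfolding good_node_def using z mass_le_outer[of z] by auto
qed

text \<open>The cell of \<open>z\<close> supplies volume \<open>s ^ n / 2\<close> inside
  \<open>\<Omega>\<close> and its neighbour as much outside, both in the inner ball; the outer
  volume is bounded by that of the whole ball.\<close>

lemma good_nodeI_thick:
  assumes z: "s ^ CARD('n) / 2 < mass z" "mass (z + axis i 1) \<le> s ^ CARD('n) / 2"
  shows "good_node \<Omega> s (good_const TYPE('n)) z"
proof -
  let ?I = "measure lborel (\<Omega> \<inter> inner_ball s z)" and ?J = "measure lborel (inner_ball s z - \<Omega>)"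
  let ?\<omega> = "unit_ball_vol (real CARD('n)) * (6 * real CARD('n)) ^ CARD('n)" and ?q = "s ^ CARD('n)"
  have q: "?q > 0" using s by simp
  have J: "?q / 2 \<le> ?J"
    using complement_le_inner[OF neighbour_cell_subset_inner_ball[OF s, of z i]] z(2) by linarith
  have I: "?q / 2 \<le> ?I" using mass_le_inner[of z] z(1) by linarith
  have "measure lborel (\<Omega> \<inter> outer_ball s z) \<le> measure lborel (outer_ball s z)"
    using \<Omega> emeasure_bounded_finite[OF bounded_ball, of "node s z"]
    by (intro measure_mono_fmeasurable fmeasurableI) (auto simp: outer_ball_def)
  also have "\<dots> = ?\<omega> * ?q"
    using s by (simp add: outer_ball_def content_ball power_mult_distrib)
  finally have "measure lborel (\<Omega> \<inter> outer_ball s z) * ?q \<le> (?\<omega> * ?q) * ?q"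
    using q by (intro mult_right_mono) auto
  also have "\<dots> = 4 * ?\<omega> * ((?q / 2) * (?q / 2))" by simp
  also have "\<dots> \<le> 4 * ?\<omega> * (?I * ?J)"
    using I J q by (intro mult_left_mono mult_mono) auto
  also have "\<dots> \<le> good_const TYPE('n) * (?I * ?J)"
    by (intro mult_right_mono) (auto simp: good_const_def)
  finally show ?thesis
    unfolding good_node_def using z q mass_le_outer[of z] by auto
qed

text \<open>The power \<open>\<tau> ^ (n - 1)\<close> is the order of the number of cells along the
  surface of a cube of side \<open>\<tau> s\<close>, as the thick case suggests; the thin case even
  yields the order \<open>\<tau> ^ n\<close>.\<close>

lemma many_good_nodes:
  assumes \<tau>: "\<tau> \<ge> 1" "(\<tau> * s) ^ CARD('n) \<le> measure lborel \<Omega>"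
  shows "\<exists>G. finite G \<and> (\<forall>z\<in>G. good_node \<Omega> s (good_const TYPE('n)) z) \<and>
    \<tau> ^ (CARD('n) - 1) \<le> 16 * real CARD('n) * real (card G)"
proof -
  let ?q = "s ^ CARD('n)" and ?V = "measure lborel \<Omega>"
  let ?c = "real (card (offsets :: (int^'n) set))"
  have n: "CARD('n) \<ge> 1" by (simp add: Suc_le_eq)
  have q: "?q > 0" using s by simp
  have \<tau>q: "\<tau> ^ CARD('n) * ?q \<le> ?V" using \<tau>(2) by (simp add: power_mult_distrib)
  have \<tau>n: "\<tau> ^ CARD('n) = \<tau> * \<tau> ^ (CARD('n) - 1)" using n by (simp flip: power_Suc)
  define F where "F = {z \<in> Cells. ?q / 2 < mass z}"
  have F: "finite F" "F \<subseteq> Cells" using finite_Cells by (auto simp: F_def)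
  have "?V = (\<Sum>z\<in>F. mass z) + (\<Sum>z\<in>Cells - F. mass z)"
    unfolding sum_mass_Cells[symmetric] using F finite_Cells
    by (metis add.commute sum.subset_diff)
  then consider (thick) "?V / 2 \<le> (\<Sum>z\<in>F. mass z)" | (thin) "?V / 2 \<le> (\<Sum>z\<in>Cells - F. mass z)"
    by linarith
  then show ?thesis
  proof cases
    case thin
    define b where "b z = measure lborel (\<Omega> \<inter> outer_ball s z)" for z
    define G where "G = {z \<in> Cells - F. 0 < mass z \<and> b z \<le> 4 * ?c * mass z}"
    have G: "finite G" "G \<subseteq> Cells - F" using finite_Cells by (auto simp: G_def)
    have c: "?c > 0" using offsets_nonempty by simp
    \<comment> \<open>Rejected cells have outer volume at least \<open>4 c\<close> times their mass,
      while all outer volumes together are at most \<open>c V\<close> by double counting. Hence the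
      rejected cells carry at most \<open>V / 4\<close>, and at least \<open>V / 4\<close> remains
      for \<open>G\<close>.\<close>
    have "4 * ?c * (\<Sum>z\<in>Cells - F - G. mass z) \<le> (\<Sum>z\<in>Cells - F - G. b z)"
      unfolding sum_distrib_left
    proof (rule sum_mono)
      fix z assume "z \<in> Cells - F - G"
      then have "mass z = 0 \<or> 4 * ?c * mass z < b z"
        using mass_nonneg[of z] by (auto simp: G_def)
      then show "4 * ?c * mass z \<le> b z" by (auto simp: b_def)
    qed
    also have "\<dots> \<le> (\<Sum>z\<in>Cells. b z)"
      using finite_Cells by (intro sum_mono2) (auto simp: b_def)
    also have "\<dots> \<le> (\<Sum>z\<in>Cells. \<Sum>w\<in>offsets. mass (z + w))"
      unfolding b_def by (intro sum_mono outer_le_sum_mass)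
    also have "\<dots> = (\<Sum>w\<in>offsets. \<Sum>z\<in>Cells. mass (z + w))"
      by (rule sum.swap)
    also have "\<dots> \<le> (\<Sum>w\<in>(offsets :: (int^'n) set). ?V)"
    proof (rule sum_mono)
      fix w :: "int^'n"
      have "(\<Sum>z\<in>Cells. mass (z + w)) = (\<Sum>z\<in>(\<lambda>z. z + w) ` Cells. mass z)"
        by (subst sum.reindex) (auto simp: inj_on_def)
      then show "(\<Sum>z\<in>Cells. mass (z + w)) \<le> ?V"
        using sum_mass_le finite_Cells by simp
    qed
    also have "\<dots> = ?c * ?V" by simp
    finally have "?c * (4 * (\<Sum>z\<in>Cells - F - G. mass z)) \<le> ?c * ?V" by (simp only: mult_ac)
    then have "4 * (\<Sum>z\<in>Cells - F - G. mass z) \<le> ?V"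
      using c by (simp only: mult_le_cancel_left_pos)
    moreover have "(\<Sum>z\<in>Cells - F. mass z) = (\<Sum>z\<in>Cells - F - G. mass z) + (\<Sum>z\<in>G. mass z)"
      using G finite_Cells by (intro sum.subset_diff) auto
    ultimately have "?V / 4 \<le> (\<Sum>z\<in>G. mass z)" using thin by linarith
    also have "\<dots> \<le> real (card G) * (?q / 2)"
      by (rule sum_bounded_above) (auto simp: G_def F_def)
    finally have "\<tau> ^ CARD('n) * ?q \<le> (2 * real (card G)) * ?q" using \<tau>q by linarith
    then have "\<tau> ^ CARD('n) \<le> 2 * real (card G)"
      using q by (simp only: mult_le_cancel_right_pos)
    moreover have "\<tau> ^ (CARD('n) - 1) \<le> \<tau> ^ CARD('n)"
      using \<tau> by (intro power_increasing) auto
    moreover have "2 * real (card G) \<le> 16 * real CARD('n) * real (card G)"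
    proof (rule mult_right_mono)
      show "2 \<le> 16 * real CARD('n)" using n by linarith
    qed simp
    ultimately have "\<tau> ^ (CARD('n) - 1) \<le> 16 * real CARD('n) * real (card G)" by linarith
    moreover have "good_node \<Omega> s (good_const TYPE('n)) z" if "z \<in> G" for z
      using that by (intro good_nodeI_thin) (auto simp: G_def F_def b_def)
    ultimately show ?thesis using G by blast
  next
    case thick
    have "(\<Sum>z\<in>F. mass z) \<le> real (card F) * ?q"
      by (rule sum_bounded_above) (rule mass_le)
    then have "\<tau> ^ CARD('n) * ?q \<le> (2 * real (card F)) * ?q"
      using thick \<tau>q by linarith
    then have N: "\<tau> ^ CARD('n) \<le> 2 * real (card F)"
      using q by (simp only: mult_le_cancel_right_pos)
    \<comment> \<open>With \<open>r ^ n = 2 * card F\<close> the rounded-up side \<open>l\<close>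
      meets the hypothesis of the discrete isoperimetric inequality, and \<open>l <= 2 r\<close>
      because \<open>r >= 1\<close>.\<close>
    define r where "r = root CARD('n) (2 * real (card F))"
    have rn: "r ^ CARD('n) = 2 * real (card F)"
      using n by (simp add: r_def real_root_pow_pos2)
    have r\<tau>: "r \<ge> \<tau>"
    proof -
      have "root CARD('n) (\<tau> ^ CARD('n)) \<le> r"
        unfolding r_def using n N by (intro real_root_le_mono) auto
      then show ?thesis using n \<tau> by (simp add: real_root_power_cancel)
    qed
    define l where "l = nat \<lceil>r\<rceil>"
    have l: "r \<le> real l" "real l \<le> 2 * r"
      using r\<tau> \<tau>(1) unfolding l_def by linarith+
    have "real (2 * card F) \<le> real (l ^ CARD('n))"
      using power_mono[OF l(1), of "CARD('n)"] r\<tau> \<tau>(1) by (simp add: rn)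
    then have "card F \<le> 2 * CARD('n) * l * card (inner_boundary F)"
      using F by (intro discrete_isoperimetric_inequality) linarith+
    then have "real (card F) \<le> real (2 * CARD('n) * l * card (inner_boundary F))"
      by (rule of_nat_mono)
    also have "\<dots> = real l * (2 * real CARD('n) * real (card (inner_boundary F)))" by simp
    also have "\<dots> \<le> (2 * r) * (2 * real CARD('n) * real (card (inner_boundary F)))"
      using l by (intro mult_right_mono) auto
    finally have "r ^ CARD('n) \<le> r * (8 * real CARD('n) * real (card (inner_boundary F)))"
      unfolding rn by (simp add: mult_ac)
    moreover have "r ^ CARD('n) = r * r ^ (CARD('n) - 1)" using n by (simp flip: power_Suc)
    moreover have "r > 0" using r\<tau> \<tau>(1) by linarith
    ultimately have "r ^ (CARD('n) - 1) \<le> 8 * real CARD('n) * real (card (inner_boundary F))"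
      by (simp only: mult_le_cancel_left_pos)
    moreover have "\<tau> ^ (CARD('n) - 1) \<le> r ^ (CARD('n) - 1)"
      using r\<tau> \<tau> by (intro power_mono) auto
    ultimately have "\<tau> ^ (CARD('n) - 1) \<le> 16 * real CARD('n) * real (card (inner_boundary F))"
      by (smt (verit) mult_right_mono of_nat_0_le_iff)
    moreover have "good_node \<Omega> s (good_const TYPE('n)) z" if zF: "z \<in> inner_boundary F" for z
    proof -
      obtain i where i: "z \<in> F" "z + axis i 1 \<notin> F" using zF by (auto simp: inner_boundary_def)
      \<comment> \<open>A neighbour outside \<open>F\<close> either misses \<open>\<Omega>\<close>
        and has mass 0, or is a cell filled at most half.\<close>
      have "mass (z + axis i 1) \<le> ?q / 2"
        using i(2) mass_outside[of "z + axis i 1"] q by (cases "z + axis i 1 \<in> Cells") (auto simp: F_def)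
      then show ?thesis
        using i(1) by (intro good_nodeI_thick[of z i]) (auto simp: F_def)
    qed
    moreover have "finite (inner_boundary F)"
      using F by (auto simp: inner_boundary_def)
    ultimately show ?thesis by blast
  qed
qed

end

section \<open>Test functions and eigenvalue bounds\<close>

text \<open>\<^const>\<open>measure_of\<close> yields the zero measure when the given set function is not a measure, so a
  nonzero area alone already shows that the Hausdorff outer measure is one on the Borel sets.\<close>

lemma emeasure_boundary_measure:
  fixes \<Omega> :: "(real^'n) set"
  assumes "boundary_area \<Omega> \<noteq> 0" "A \<in> sets borel" "A \<subseteq> frontier \<Omega>"
  shows "emeasure (boundary_measure \<Omega>) A = hausdorff_outer (CARD('n) - 1) A"
proof -
  have restrict: "emeasure (boundary_measure \<Omega>) B = emeasure (hausdorff_measure (CARD('n) - 1)) B"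
    if "B \<subseteq> frontier \<Omega>" for B
    unfolding boundary_measure_def using that by (intro emeasure_restrict_space) auto
  have "emeasure (hausdorff_measure (CARD('n) - 1)) (frontier \<Omega>) \<noteq> 0"
    using assms(1) restrict[of "frontier \<Omega>"] by (auto simp: boundary_area_def measure_def)
  then have "measure_space UNIV (sigma_sets UNIV (sets borel))
      (hausdorff_outer (CARD('n) - 1) :: (real^'n) set \<Rightarrow> ennreal)"
    unfolding hausdorff_measure_def emeasure_measure_of_conv by (auto split: if_splits)
  then show ?thesis
    using restrict[OF assms(3)] assms(2)
    unfolding hausdorff_measure_def emeasure_measure_of_conv by auto
qed

lemma borel_measurable_boundary_continuous:
  fixes f :: "real^'n \<Rightarrow> 'b::euclidean_space"
  assumes "continuous_on UNIV f"
  shows "f \<in> borel_measurable (boundary_measure \<Omega>)"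
  unfolding boundary_measure_def
  using borel_measurable_continuous_onI[OF assms]
  by (intro measurable_restrict_space1) (simp add: measurable_def)

text \<open>At most one \<open>v i\<close> is nonzero. The vector-valued form serves gradients and
  boundary values alike.\<close>

lemma norm_sum_disjoint:
  fixes v :: "nat \<Rightarrow> 'a::real_normed_vector"
  assumes "\<And>i j. i < k \<Longrightarrow> j < k \<Longrightarrow> i \<noteq> j \<Longrightarrow> v i = 0 \<or> v j = 0"
  shows "(norm (\<Sum>i<k. c i *\<^sub>R v i))\<^sup>2 = (\<Sum>i<k. (c i)\<^sup>2 * (norm (v i))\<^sup>2)"
proof (cases "\<exists>i<k. v i \<noteq> 0")
  case True
  then obtain i where i: "i < k" "v i \<noteq> 0" by blast
  then have zero: "v j = 0" if "j < k" "j \<noteq> i" for j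
    using assms[of i j] that by blast
  have "(\<Sum>j<k. c j *\<^sub>R v j) = (\<Sum>j\<in>{i}. c j *\<^sub>R v j)"
    using i zero by (intro sum.mono_neutral_right) auto
  moreover have "(\<Sum>j<k. (c j)\<^sup>2 * (norm (v j))\<^sup>2) = (\<Sum>j\<in>{i}. (c j)\<^sup>2 * (norm (v j))\<^sup>2)"
    using i zero by (intro sum.mono_neutral_right) auto
  ultimately show ?thesis by (simp add: power_mult_distrib)
qed (auto intro: sum.neutral)

text \<open>Linear independence: where \<open>\<phi> i\<close> is nonzero, a set of positive volume
  in \<open>\<Omega>\<close>, every linear combination reduces to
  \<open>c i * \<phi> i\<close>.\<close>

lemma H1_frame_disjoint:
  fixes \<phi> :: "nat \<Rightarrow> real^'n \<Rightarrow> real"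
  assumes \<Omega>: "open \<Omega>" "bounded \<Omega>" "boundary_area \<Omega> \<noteq> 0"
    and smooth: "\<And>i. i < k \<Longrightarrow> smooth_on UNIV (\<phi> i)"
    and disj: "\<And>i j x. i < k \<Longrightarrow> j < k \<Longrightarrow> i \<noteq> j \<Longrightarrow> \<phi> i x = 0 \<or> \<phi> j x = 0"
    and nz: "\<And>i. i < k \<Longrightarrow> emeasure lborel {x \<in> \<Omega>. \<phi> i x \<noteq> 0} \<noteq> 0"
  shows "H1_frame \<Omega> k \<phi> (\<lambda>i. grad (\<phi> i)) \<phi>"
  unfolding H1_frame_def
proof (intro conjI allI impI)
  fix c :: "nat \<Rightarrow> real" and i
  assume ae: "AE x in lebesgue_on \<Omega>. (\<Sum>i<k. c i * \<phi> i x) = 0" and i: "i < k"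
  show "c i = 0"
  proof (rule ccontr)
    assume c: "c i \<noteq> 0"
    let ?S = "{x \<in> \<Omega>. \<phi> i x \<noteq> 0}"
    have S: "?S \<in> sets lborel"
    proof -
      have [measurable]: "\<phi> i \<in> borel_measurable borel"
        by (rule borel_measurable_continuous_onI[OF smooth_onD(3)[OF smooth[OF i]]])
      have [measurable]: "\<Omega> \<in> sets borel" using \<Omega> by simp
      show ?thesis by measurable
    qed
    have "AE x in lebesgue. x \<in> \<Omega> \<longrightarrow> (\<Sum>i<k. c i * \<phi> i x) = 0"
      using ae \<Omega> by (subst (asm) AE_restrict_space_iff) auto
    then have "AE x in lborel. x \<in> \<Omega> \<longrightarrow> (\<Sum>i<k. c i * \<phi> i x) = 0"
      by (simp only: AE_completion_iff)
    then have "AE x in lborel. x \<notin> ?S"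
    proof eventually_elim
      case (elim x)
      show ?case
      proof
        assume x: "x \<in> ?S"
        have "(\<Sum>j<k. c j * \<phi> j x) = (\<Sum>j\<in>{i}. c j * \<phi> j x)"
          using i x disj[of i _ x] by (intro sum.mono_neutral_right) auto
        then show False using elim x c by simp
      qed
    qed
    then have "?S \<in> null_sets lborel"
      using AE_iff_null_sets[OF S] by blast
    then show False using nz[OF i] by auto
  qed
qed (use H1_gradient_smooth[OF smooth \<Omega>(1,2)] has_trace_smooth[OF smooth \<Omega>] in auto)

text \<open>Without cross terms, the energy and the boundary mass of a combination are sums with the
  same weights \<open>(c i)^2\<close>, so the bound on each quotient passes to the whole span, which
  is then a competitor in the infimum.\<close>

lemma steklov_eigenvalue_le_disjoint:
  fixes \<phi> :: "nat \<Rightarrow> real^'n \<Rightarrow> real"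
  assumes \<Omega>: "open \<Omega>" "bounded \<Omega>" "boundary_area \<Omega> \<noteq> 0"
    and smooth: "\<And>i. i < k \<Longrightarrow> smooth_on UNIV (\<phi> i)"
    and disj: "\<And>i j x. i < k \<Longrightarrow> j < k \<Longrightarrow> i \<noteq> j \<Longrightarrow> \<phi> i x = 0 \<or> \<phi> j x = 0"
    and disj_grad: "\<And>i j x. i < k \<Longrightarrow> j < k \<Longrightarrow> i \<noteq> j \<Longrightarrow> grad (\<phi> i) x = 0 \<or> grad (\<phi> j) x = 0"
    and nz: "\<And>i. i < k \<Longrightarrow> emeasure lborel {x \<in> \<Omega>. \<phi> i x \<noteq> 0} \<noteq> 0"
    and bdry: "\<And>i. i < k \<Longrightarrow> (\<integral>\<^sup>+x. ennreal ((\<phi> i x)\<^sup>2) \<partial>boundary_measure \<Omega>) \<noteq> 0"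
    and energy: "\<And>i. i < k \<Longrightarrow> (\<integral>\<^sup>+x. ennreal ((norm (grad (\<phi> i) x))\<^sup>2) \<partial>lebesgue_on \<Omega>)
        \<le> K * (\<integral>\<^sup>+x. ennreal ((\<phi> i x)\<^sup>2) \<partial>boundary_measure \<Omega>)"
  shows "steklov_eigenvalue \<Omega> k \<le> K"
proof -
  let ?E = "\<lambda>i. \<integral>\<^sup>+x. ennreal ((norm (grad (\<phi> i) x))\<^sup>2) \<partial>lebesgue_on \<Omega>"
  let ?B = "\<lambda>i. \<integral>\<^sup>+x. ennreal ((\<phi> i x)\<^sup>2) \<partial>boundary_measure \<Omega>"
  have "rayleigh \<Omega> (\<lambda>x. \<Sum>i<k. c i *\<^sub>R grad (\<phi> i) x) (\<lambda>x. \<Sum>i<k. c i * \<phi> i x) \<le> K"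
    if c: "\<exists>i<k. c i \<noteq> 0" for c :: "nat \<Rightarrow> real"
  proof -
    have E: "(\<integral>\<^sup>+x. ennreal ((norm (\<Sum>i<k. c i *\<^sub>R grad (\<phi> i) x))\<^sup>2) \<partial>lebesgue_on \<Omega>)
        = (\<Sum>i<k. ennreal ((c i)\<^sup>2) * ?E i)"
    proof -
      have [measurable]: "grad (\<phi> i) \<in> borel_measurable (lebesgue_on \<Omega>)" if "i < k" for i
        using that smooth by (intro borel_measurable_lebesgue_on_continuous continuous_on_grad)
      have "(\<integral>\<^sup>+x. ennreal ((norm (\<Sum>i<k. c i *\<^sub>R grad (\<phi> i) x))\<^sup>2) \<partial>lebesgue_on \<Omega>)
          = (\<integral>\<^sup>+x. (\<Sum>i<k. ennreal ((c i)\<^sup>2) * ennreal ((norm (grad (\<phi> i) x))\<^sup>2)) \<partial>lebesgue_on \<Omega>)"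
        using norm_sum_disjoint[OF disj_grad] by (simp add: ennreal_mult flip: sum_ennreal)
      also have "\<dots> = (\<Sum>i<k. \<integral>\<^sup>+x. ennreal ((c i)\<^sup>2) * ennreal ((norm (grad (\<phi> i) x))\<^sup>2) \<partial>lebesgue_on \<Omega>)"
        by (intro nn_integral_sum) auto
      also have "\<dots> = (\<Sum>i<k. ennreal ((c i)\<^sup>2) * ?E i)"
        by (intro sum.cong refl nn_integral_cmult) auto
      finally show ?thesis .
    qed
    have B: "(\<integral>\<^sup>+x. ennreal ((\<Sum>i<k. c i * \<phi> i x)\<^sup>2) \<partial>boundary_measure \<Omega>)
        = (\<Sum>i<k. ennreal ((c i)\<^sup>2) * ?B i)"
    proof -
      have [measurable]: "\<phi> i \<in> borel_measurable (boundary_measure \<Omega>)" if "i < k" for i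
        using that smooth by (intro borel_measurable_boundary_continuous smooth_onD)
      have "(\<Sum>i<k. c i * \<phi> i x)\<^sup>2 = (\<Sum>i<k. (c i)\<^sup>2 * (\<phi> i x)\<^sup>2)" for x
        using norm_sum_disjoint[of k "\<lambda>i. \<phi> i x" c, OF disj] by simp
      then have "(\<integral>\<^sup>+x. ennreal ((\<Sum>i<k. c i * \<phi> i x)\<^sup>2) \<partial>boundary_measure \<Omega>)
          = (\<integral>\<^sup>+x. (\<Sum>i<k. ennreal ((c i)\<^sup>2) * ennreal ((\<phi> i x)\<^sup>2)) \<partial>boundary_measure \<Omega>)"
        by (simp add: ennreal_mult flip: sum_ennreal)
      also have "\<dots> = (\<Sum>i<k. \<integral>\<^sup>+x. ennreal ((c i)\<^sup>2) * ennreal ((\<phi> i x)\<^sup>2) \<partial>boundary_measure \<Omega>)"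
        by (intro nn_integral_sum) auto
      also have "\<dots> = (\<Sum>i<k. ennreal ((c i)\<^sup>2) * ?B i)"
        by (intro sum.cong refl nn_integral_cmult) auto
      finally show ?thesis .
    qed
    \<comment> \<open>This excludes the branch in which \<open>rayleigh\<close> is infinite.\<close>
    have "(\<Sum>i<k. ennreal ((c i)\<^sup>2) * ?B i) \<noteq> 0"
      using c bdry by (auto simp: sum_eq_0_iff)
    moreover have "(\<Sum>i<k. ennreal ((c i)\<^sup>2) * ?E i) \<le> (\<Sum>i<k. ennreal ((c i)\<^sup>2) * ?B i) * K"
      unfolding sum_distrib_right
    proof (rule sum_mono)
      fix i assume "i \<in> {..<k}"
      then have "ennreal ((c i)\<^sup>2) * ?E i \<le> ennreal ((c i)\<^sup>2) * (K * ?B i)"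
        using energy by (intro mult_left_mono) auto
      then show "ennreal ((c i)\<^sup>2) * ?E i \<le> ennreal ((c i)\<^sup>2) * ?B i * K"
        by (simp only: mult_ac)
    qed
    ultimately show ?thesis
      unfolding rayleigh_def Let_def E B
      by (simp only: if_False) (rule divide_le_posI_ennreal, simp only: zero_less_iff_neq_zero not_False_eq_True)
  qed
  moreover have "H1_frame \<Omega> k \<phi> (\<lambda>i. grad (\<phi> i)) \<phi>"
    by (intro H1_frame_disjoint \<Omega> smooth disj nz)
  ultimately show ?thesis
    unfolding steklov_eigenvalue_def
    by (intro INF_lower2[of "(\<phi>, \<lambda>i. grad (\<phi> i), \<phi>)"]) (auto intro!: SUP_least)
qed

text \<open>The factor 16 comes from the squared gradient bound \<open>4 / R\<close>, the power of
  \<open>6 n\<close> from \<open>R ^ (n - 1)\<close> with \<open>R = 6 n s\<close>, and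
  \<open>exp 4\<close> from the squared lower bound \<open>exp (- 2)\<close> of the bump.\<close>

definition rayleigh_const :: "'n::finite itself \<Rightarrow> real" where
  "rayleigh_const _ = 16 * good_const TYPE('n) * isop_const CARD('n) *
     (6 * real CARD('n)) ^ (CARD('n) - 1) * exp 4"

section \<open>From good nodes to the eigenvalue bound\<close>

lemma good_const_pos: "good_const TYPE('n::finite) > 0"
  using offsets_nonempty[where 'n = 'n] by (auto simp: good_const_def intro!: add_pos_nonneg)

lemma rayleigh_const_pos: "rayleigh_const TYPE('n::finite) > 0"
  using good_const_pos[where 'n = 'n] isop_const_pos by (simp add: rayleigh_const_def)

text \<open>The energy is at most \<open>(4 / R)^2\<close> times the outer volume, which goodness
  and the relative isoperimetric inequality bound by a multiple of
  \<open>R ^ (n + 1) / s ^ n\<close> times the boundary mass of the inner ball. As \<open>R\<close>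
  is a multiple of \<open>s\<close>, the total factor scales like \<open>1 / s\<close>.\<close>

lemma good_node_bump:
  fixes \<Omega> :: "(real^'n) set"
  assumes n: "2 \<le> CARD('n)" and \<Omega>: "open \<Omega>" "bounded \<Omega>" "boundary_area \<Omega> \<noteq> 0" and s: "s > 0"
    and good: "good_node \<Omega> s (good_const TYPE('n)) z"
  defines "\<phi> \<equiv> bump (node s z) (6 * real CARD('n) * s)"
  shows "(\<integral>\<^sup>+x. ennreal ((\<phi> x)\<^sup>2) \<partial>boundary_measure \<Omega>) \<noteq> 0"
    and "(\<integral>\<^sup>+x. ennreal ((norm (grad \<phi> x))\<^sup>2) \<partial>lebesgue_on \<Omega>)
      \<le> ennreal (rayleigh_const TYPE('n) / s) * (\<integral>\<^sup>+x. ennreal ((\<phi> x)\<^sup>2) \<partial>boundary_measure \<Omega>)"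
proof -
  \<comment> \<open>Both the radius of the outer ball and the diameter of the inner one.\<close>
  define R where "R = 6 * real CARD('n) * s"
  have R: "R > 0" using s by (simp add: R_def)
  define b where "b = measure lborel (\<Omega> \<inter> outer_ball s z)"
  define H where "H = hausdorff_outer (CARD('n) - 1) (frontier \<Omega> \<inter> inner_ball s z)"
  let ?I = "measure lborel (\<Omega> \<inter> inner_ball s z)" and ?J = "measure lborel (inner_ball s z - \<Omega>)"
  let ?K = "good_const TYPE('n)" and ?q = "s ^ CARD('n)" and ?c = "isop_const CARD('n) * R ^ (CARD('n) + 1)"
  have b: "b > 0" "b * ?q \<le> ?K * (?I * ?J)"
    using good by (auto simp: good_node_def b_def)
  have fin: "emeasure lborel A = ennreal (measure lborel A)" if "bounded A" for A :: "(real^'n) set"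
    using emeasure_bounded_finite[OF that] by (simp add: emeasure_eq_ennreal_measure)
  have bdd: "bounded (\<Omega> \<inter> outer_ball s z)" "bounded (\<Omega> \<inter> inner_ball s z)" "bounded (inner_ball s z - \<Omega>)"
    by (auto simp: outer_ball_def inner_ball_def intro: bounded_subset[OF bounded_ball])
  have "emeasure lborel (\<Omega> \<inter> inner_ball s z) * emeasure lborel (inner_ball s z - \<Omega>)
      \<le> ennreal (isop_const DIM(real^'n) * R ^ (DIM(real^'n) + 1))
        * hausdorff_outer (DIM(real^'n) - 1) (frontier \<Omega> \<inter> inner_ball s z)"
  proof (rule relative_isoperimetric_inequality)
    fix x y assume "x \<in> inner_ball s z" "y \<in> inner_ball s z"
    then show "dist x y \<le> R"
      using dist_triangle3[of x y "node s z"] by (simp add: inner_ball_def R_def)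
  qed (use n \<Omega> R in \<open>auto simp: inner_ball_def\<close>)
  then have IJ: "ennreal (?I * ?J) \<le> ennreal ?c * H"
    by (simp add: fin bdd ennreal_mult H_def)
  have "ennreal (b * ?q) \<le> ennreal (?K * (?I * ?J))"
    by (rule ennreal_leI) (rule b)
  also have "\<dots> = ennreal ?K * ennreal (?I * ?J)"
    using good_const_pos[where 'n = 'n] by (intro ennreal_mult) auto
  also have "\<dots> \<le> ennreal ?K * (ennreal ?c * H)"
    by (intro mult_left_mono IJ) auto
  finally have bq: "ennreal (b * ?q) \<le> ennreal ?K * (ennreal ?c * H)" .
  have q: "?q > 0" using s by simp
  have "b * ?q > 0" using b(1) q by simp
  \<comment> \<open>Positive outer volume thus forces positive boundary mass near the node.\<close>
  then have H0: "H \<noteq> 0"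
    using bq by (auto simp: ennreal_eq_0_iff)
  let ?B = "\<integral>\<^sup>+x. ennreal ((\<phi> x)\<^sup>2) \<partial>boundary_measure \<Omega>"
  have HB: "ennreal (exp (- 4)) * H \<le> ?B"
  proof -
    have A: "frontier \<Omega> \<inter> inner_ball s z \<in> sets borel"
      by (auto simp: inner_ball_def)
    then have A': "frontier \<Omega> \<inter> inner_ball s z \<in> sets (boundary_measure \<Omega>)"
      by (auto simp: boundary_measure_def sets_restrict_space)
    have "ennreal (exp (- 4)) * H
        = ennreal (exp (- 4)) * emeasure (boundary_measure \<Omega>) (frontier \<Omega> \<inter> inner_ball s z)"
      using emeasure_boundary_measure[OF \<Omega>(3) A] by (simp add: H_def)
    also have "\<dots> = (\<integral>\<^sup>+x. ennreal (exp (- 4)) * indicator (frontier \<Omega> \<inter> inner_ball s z) x \<partial>boundary_measure \<Omega>)"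
      using A' by (simp add: nn_integral_cmult_indicator)
    also have "\<dots> \<le> ?B"
    proof (intro nn_integral_mono)
      fix x
      show "ennreal (exp (- 4)) * indicator (frontier \<Omega> \<inter> inner_ball s z) x \<le> ennreal ((\<phi> x)\<^sup>2)"
      proof (cases "x \<in> inner_ball s z")
        case True
        then have "x \<in> ball (node s z) (R / 2)" by (simp add: inner_ball_def R_def mult_ac)
        then have "exp (- 2) \<le> \<phi> x"
          unfolding \<phi>_def R_def[symmetric] by (rule bump_lower_bound[OF R])
        then have "(exp (- 2))\<^sup>2 \<le> (\<phi> x)\<^sup>2" by (intro power_mono) auto
        then have "exp (- 4) \<le> (\<phi> x)\<^sup>2" by (simp flip: exp_double)
        then show ?thesis by (auto simp: indicator_def intro: ennreal_leI)
      qed simp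
    qed
    finally show ?thesis .
  qed
  then show B0: "?B \<noteq> 0"
    using H0 by (auto simp: ennreal_eq_0_iff)
  have "(\<integral>\<^sup>+x. ennreal ((norm (grad \<phi> x))\<^sup>2) \<partial>lebesgue_on \<Omega>)
      = (\<integral>\<^sup>+x. ennreal ((norm (grad \<phi> x))\<^sup>2) * indicator \<Omega> x \<partial>lebesgue)"
    using \<Omega> by (intro nn_integral_restrict_space) auto
  also have "\<dots> \<le> (\<integral>\<^sup>+x. ennreal ((4 / R)\<^sup>2) * indicator (\<Omega> \<inter> outer_ball s z) x \<partial>lebesgue)"
  proof (intro nn_integral_mono)
    fix x
    show "ennreal ((norm (grad \<phi> x))\<^sup>2) * indicator \<Omega> x
        \<le> ennreal ((4 / R)\<^sup>2) * indicator (\<Omega> \<inter> outer_ball s z) x"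
    proof (cases "x \<in> outer_ball s z")
      case True
      have "(norm (grad \<phi> x))\<^sup>2 \<le> (4 / R)\<^sup>2"
        unfolding \<phi>_def R_def[symmetric] using norm_grad_bump_le[OF R] by (intro power_mono) auto
      with True show ?thesis by (auto simp: indicator_def intro: ennreal_leI)
    next
      case False
      then have "grad \<phi> x = 0"
        unfolding \<phi>_def R_def[symmetric]
        using R by (intro grad_bump_eq_0) (auto simp: outer_ball_def R_def)
      then show ?thesis by simp
    qed
  qed
  also have "\<dots> = ennreal ((4 / R)\<^sup>2) * ennreal b"
    using \<Omega> fin[OF bdd(1)]
    by (subst nn_integral_cmult_indicator) (auto simp: outer_ball_def b_def)
  also have "\<dots> = ennreal ((4 / R)\<^sup>2 / ?q) * ennreal (b * ?q)"
    using q b s by (simp flip: ennreal_mult)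
  also have "\<dots> \<le> ennreal ((4 / R)\<^sup>2 / ?q) * (ennreal ?K * (ennreal ?c * H))"
    by (intro mult_left_mono bq) auto
  also have "\<dots> = ennreal ((4 / R)\<^sup>2 / ?q * (?K * ?c)) * H"
  proof -
    have "0 \<le> (4 / R)\<^sup>2 / ?q" "0 \<le> ?K" "0 \<le> ?c"
      using q R good_const_pos[where 'n = 'n] isop_const_pos[of "CARD('n)"] by auto
    then have "ennreal ((4 / R)\<^sup>2 / ?q * (?K * ?c)) = ennreal ((4 / R)\<^sup>2 / ?q) * (ennreal ?K * ennreal ?c)"
      by (simp only: ennreal_mult mult_nonneg_nonneg)
    then show ?thesis by (simp only: mult.assoc)
  qed
  also have "(4 / R)\<^sup>2 / ?q * (?K * ?c) = rayleigh_const TYPE('n) / s * exp (- 4)"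
  proof -
    have pw: "R ^ (CARD('n) + 1) = R\<^sup>2 * R ^ (CARD('n) - 1)"
      using n by (simp flip: power_add)
    have q': "?q = s * s ^ (CARD('n) - 1)"
      using n by (simp flip: power_Suc)
    have "(4 / R)\<^sup>2 / ?q * (?K * ?c) = 16 * ?K * isop_const CARD('n) * R ^ (CARD('n) - 1) / ?q"
      unfolding pw using R by (simp add: power_divide)
    also have "\<dots> = 16 * ?K * isop_const CARD('n) * (6 * real CARD('n)) ^ (CARD('n) - 1) / s"
      unfolding q' using s by (simp add: R_def power_mult_distrib)
    also have "\<dots> = rayleigh_const TYPE('n) / s * exp (- 4)"
      by (simp add: rayleigh_const_def exp_minus)
    finally show ?thesis .
  qed
  also have "ennreal (rayleigh_const TYPE('n) / s * exp (- 4)) * H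
      = ennreal (rayleigh_const TYPE('n) / s) * (ennreal (exp (- 4)) * H)"
  proof -
    have "ennreal (rayleigh_const TYPE('n) / s * exp (- 4))
        = ennreal (rayleigh_const TYPE('n) / s) * ennreal (exp (- 4))"
      using rayleigh_const_pos[where 'n = 'n] s by (intro ennreal_mult) auto
    then show ?thesis by (simp only: mult.assoc)
  qed
  also have "\<dots> \<le> ennreal (rayleigh_const TYPE('n) / s) * ?B"
    by (intro mult_left_mono HB) auto
  finally show "(\<integral>\<^sup>+x. ennreal ((norm (grad \<phi> x))\<^sup>2) \<partial>lebesgue_on \<Omega>)
      \<le> ennreal (rayleigh_const TYPE('n) / s) * ?B" .
qed

text \<open>The centres are at least \<open>12 n s\<close> apart, the sum of the two radii.\<close>

lemma disjoint_outer_balls: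
  fixes z z' :: "int^'n"
  assumes s: "s > 0" and sep: "int (12 * CARD('n)) \<le> \<bar>z $ i - z' $ i\<bar>"
  shows "outer_ball s z \<inter> outer_ball s z' = {}"
proof -
  have False if x: "x \<in> outer_ball s z" "x \<in> outer_ball s z'" for x
  proof -
    have "s * (12 * real CARD('n)) \<le> s * \<bar>real_of_int (z $ i) - real_of_int (z' $ i)\<bar>"
      using s sep by (intro mult_left_mono) linarith+
    also have "\<dots> = \<bar>(node s z - node s z') $ i\<bar>"
      using s by (simp add: node_def abs_mult flip: right_diff_distrib)
    also have "\<dots> \<le> dist (node s z) (node s z')"
      unfolding dist_norm by (rule component_le_norm_cart)
    also have "\<dots> \<le> dist (node s z) x + dist (node s z') x"
      by (rule dist_triangle2)
    also have "\<dots> < s * (12 * real CARD('n))"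
      using x by (simp add: outer_ball_def algebra_simps)
    finally show False by simp
  qed
  then show ?thesis by blast
qed

text \<open>Keeping one residue class mod \<open>12 n\<close> costs the factor
  \<open>(12 n) ^ n\<close> in the number of nodes and makes the outer balls, which support the
  bumps, disjoint.\<close>

lemma steklov_eigenvalue_le_good_nodes:
  fixes \<Omega> :: "(real^'n) set"
  assumes n: "2 \<le> CARD('n)" and \<Omega>: "open \<Omega>" "bounded \<Omega>" "boundary_area \<Omega> \<noteq> 0" and s: "s > 0"
    and G: "finite G" "\<And>z. z \<in> G \<Longrightarrow> good_node \<Omega> s (good_const TYPE('n)) z"
    and card: "(12 * CARD('n)) ^ CARD('n) * k \<le> card G"
  shows "steklov_eigenvalue \<Omega> k \<le> ennreal (rayleigh_const TYPE('n) / s)"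
proof -
  obtain G' where G': "G' \<subseteq> G" "card G' = k"
    and sep: "\<And>z z'. z \<in> G' \<Longrightarrow> z' \<in> G' \<Longrightarrow> z \<noteq> z' \<Longrightarrow> \<exists>i. int (12 * CARD('n)) \<le> \<bar>z $ i - z' $ i\<bar>"
    using exists_separated_subset[OF G(1) card] n by auto
  obtain e where "bij_betw e {0..<card G'} G'"
    using ex_bij_betw_nat_finite[OF finite_subset[OF G'(1) G(1)]] by blast
  then have e: "inj_on e {..<k}" "e ` {..<k} = G'"
    using G' by (auto simp: bij_betw_def atLeast0LessThan)
  have good: "good_node \<Omega> s (good_const TYPE('n)) (e i)" if "i < k" for i
    using that e G' G by blast
  let ?R = "6 * real CARD('n) * s"
  have R: "?R > 0" using s by simp
  have disj: "x \<notin> ball (node s (e i)) ?R \<or> x \<notin> ball (node s (e j)) ?R"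
    if "i < k" "j < k" "i \<noteq> j" for i j x
  proof -
    have "e i \<noteq> e j" using that e(1) by (auto simp: inj_on_def)
    then have "outer_ball s (e i) \<inter> outer_ball s (e j) = {}"
      using sep[of "e i" "e j"] that e(2) disjoint_outer_balls[OF s] by blast
    then show ?thesis by (auto simp: outer_ball_def)
  qed
  show ?thesis
  proof (rule steklov_eigenvalue_le_disjoint[where \<phi> = "\<lambda>i. bump (node s (e i)) ?R"])
    fix i assume i: "i < k"
    have "\<Omega> \<inter> outer_ball s (e i) = {x \<in> \<Omega>. bump (node s (e i)) ?R x \<noteq> 0}"
      using bump_eq_0[OF R] bump_pos by (fastforce simp: outer_ball_def)
    moreover have "emeasure lborel (\<Omega> \<inter> outer_ball s (e i)) \<noteq> 0"
      using good[OF i] by (auto simp: good_node_def measure_def)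
    ultimately show "emeasure lborel {x \<in> \<Omega>. bump (node s (e i)) ?R x \<noteq> 0} \<noteq> 0"
      by simp
  next
    fix i j x assume "i < k" "j < k" "i \<noteq> j"
    then show "bump (node s (e i)) ?R x = 0 \<or> bump (node s (e j)) ?R x = 0"
      "grad (bump (node s (e i)) ?R) x = 0 \<or> grad (bump (node s (e j)) ?R) x = 0"
      using disj bump_eq_0[OF R] grad_bump_eq_0[OF R] by blast+
  qed (use \<Omega> smooth_bump good_node_bump[OF n \<Omega> s good] in auto)
qed

lemma steklov_eigenvalue_bound:
  fixes \<Omega> :: "(real^'n) set"
  assumes n: "2 \<le> CARD('n)" and \<Omega>: "open \<Omega>" "bounded \<Omega>" "\<Omega> \<noteq> {}" "boundary_area \<Omega> \<noteq> 0" and k: "1 \<le> k"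
  shows "steklov_eigenvalue \<Omega> k
    \<le> ennreal (rayleigh_const TYPE('n)
        * (16 * real CARD('n) * (12 * real CARD('n)) ^ CARD('n) * real k) powr (1 / (real CARD('n) - 1))
        / measure lebesgue \<Omega> powr (1 / real CARD('n)))"
proof -
  let ?n = "CARD('n)" and ?V = "measure lborel \<Omega>"
  let ?a = "16 * real ?n * (12 * real ?n) ^ ?n * real k"
  \<comment> \<open>Chosen so that \<open>\<tau> ^ (n - 1)\<close> is \<open>?a\<close>: cancelling
    \<open>16 n\<close> in the count of good nodes leaves the \<open>(12 n) ^ n * k\<close> nodes
    required. The scale \<open>s\<close> then satisfies \<open>(\<tau> s) ^ n = V\<close>.\<close>
  define \<tau> where "\<tau> = ?a powr (1 / (real ?n - 1))"
  define s where "s = ?V powr (1 / real ?n) / \<tau>"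
  have V: "?V > 0"
  proof -
    have "emeasure lborel \<Omega> \<noteq> 0"
      using open_not_negligible[OF \<Omega>(1,3)] \<Omega>(1) negligible_iff_emeasure0[of \<Omega>] by simp
    moreover have "emeasure lborel \<Omega> < \<infinity>"
      using \<Omega>(2) by (rule emeasure_bounded_finite)
    ultimately show ?thesis
      by (simp add: measure_def enn2real_positive_iff zero_less_iff_neq_zero)
  qed
  have a: "?a \<ge> 1"
  proof -
    have "1 \<le> (12 * real ?n) ^ ?n" using n by (intro one_le_power) linarith
    then have "1 * 1 * 1 \<le> (16 * real ?n) * (12 * real ?n) ^ ?n * real k"
      using n k by (intro mult_mono) auto
    then show ?thesis by simp
  qed
  have \<tau>: "\<tau> \<ge> 1"
    unfolding \<tau>_def using a n by (intro ge_one_powr_ge_zero) auto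
  have \<tau>n: "\<tau> ^ (?n - 1) = ?a"
  proof -
    have "\<tau> ^ (?n - 1) = \<tau> powr real (?n - 1)" using \<tau> by (subst powr_realpow) auto
    also have "\<dots> = ?a powr 1"
      unfolding \<tau>_def powr_powr using n by (simp add: of_nat_diff)
    finally show ?thesis using a by simp
  qed
  have s: "s > 0" using V \<tau> by (simp add: s_def)
  have "(\<tau> * s) ^ ?n = ?V"
  proof -
    have "\<tau> * s = ?V powr (1 / real ?n)" using \<tau> by (simp add: s_def)
    moreover have "(?V powr (1 / real ?n)) ^ ?n = (?V powr (1 / real ?n)) powr real ?n"
      using V by (subst powr_realpow) auto
    ultimately show ?thesis using V n by (simp add: powr_powr)
  qed
  then obtain G where G: "finite G" "\<And>z. z \<in> G \<Longrightarrow> good_node \<Omega> s (good_const TYPE('n)) z"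
    "\<tau> ^ (?n - 1) \<le> 16 * real ?n * real (card G)"
    using many_good_nodes[OF \<Omega>(1,2) s \<tau>] by auto
  have "(16 * real ?n) * real ((12 * ?n) ^ ?n * k) \<le> (16 * real ?n) * real (card G)"
    using G(3) \<tau>n by (simp add: mult.assoc)
  then have "real ((12 * ?n) ^ ?n * k) \<le> real (card G)"
    by (rule mult_left_le_imp_le) (use n in simp)
  then have "steklov_eigenvalue \<Omega> k \<le> ennreal (rayleigh_const TYPE('n) / s)"
    by (intro steklov_eigenvalue_le_good_nodes[OF n \<Omega>(1,2,4) s G(1,2)]) (simp_all only: of_nat_le_iff)
  moreover have "measure lebesgue \<Omega> = ?V"
    using \<Omega>(1) by (simp add: measure_completion)
  ultimately show ?thesis
    by (simp add: s_def \<tau>_def)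
qed

theorem corollary1p3:
  assumes "2 \<le> CARD('n::finite)"
  shows "\<exists>C>0. \<forall>(\<Omega> :: (real^'n) set) k. smooth_bounded_domain \<Omega> \<and> 1 \<le> k \<longrightarrow>
    ennreal (boundary_area \<Omega> powr (1 / (real CARD('n) - 1))) * steklov_eigenvalue \<Omega> k
      \<le> ennreal (C * isoperimetric_ratio \<Omega> powr (1 / (real CARD('n) - 1))
                   * real k powr (1 / (real CARD('n) - 1)))"
proof -
  let ?n = "real CARD('n)"
  let ?p = "1 / (?n - 1)"
  define C where "C = rayleigh_const TYPE('n) * (16 * ?n * (12 * ?n) ^ CARD('n)) powr ?p"
  have C: "C > 0" using rayleigh_const_pos[where 'n = 'n] by (simp add: C_def)
  have "ennreal (boundary_area \<Omega> powr ?p) * steklov_eigenvalue \<Omega> k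
      \<le> ennreal (C * isoperimetric_ratio \<Omega> powr ?p * real k powr ?p)"
    if "smooth_bounded_domain \<Omega>" "1 \<le> k" for \<Omega> :: "(real^'n) set" and k
  \<comment> \<open>For area 0 the left-hand side vanishes, since \<open>0 powr p = 0\<close>; this
    includes infinite boundary mass, which \<open>measure\<close> maps to 0.\<close>
  proof (cases "boundary_area \<Omega> = 0")
    case False
    let ?A = "boundary_area \<Omega>" and ?V = "measure lebesgue \<Omega>"
    have \<Omega>: "open \<Omega>" "bounded \<Omega>" "\<Omega> \<noteq> {}"
      using that by (auto simp: smooth_bounded_domain_def)
    have "?A \<ge> 0" by (simp add: boundary_area_def)
    \<comment> \<open>The exponent \<open>(n - 1) / n\<close> of the volume becomes
      \<open>1 / n\<close>, and the power of the area is the one on the left-hand side of the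
      claim.\<close>
    have ratio: "isoperimetric_ratio \<Omega> powr ?p = ?A powr ?p / ?V powr (1 / ?n)"
      unfolding isoperimetric_ratio_def using assms \<open>?A \<ge> 0\<close>
      by (simp add: powr_divide powr_powr)
    have "ennreal (?A powr ?p) * steklov_eigenvalue \<Omega> k
        \<le> ennreal (?A powr ?p) * ennreal (rayleigh_const TYPE('n)
          * (16 * ?n * (12 * ?n) ^ CARD('n) * real k) powr ?p / ?V powr (1 / ?n))"
      by (intro mult_left_mono steklov_eigenvalue_bound[OF assms \<Omega> False that(2)]) simp
    also have "\<dots> = ennreal (?A powr ?p * (rayleigh_const TYPE('n)
          * (16 * ?n * (12 * ?n) ^ CARD('n) * real k) powr ?p / ?V powr (1 / ?n)))"
      using rayleigh_const_pos[where 'n = 'n] by (intro ennreal_mult[symmetric]) auto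
    also have "?A powr ?p * (rayleigh_const TYPE('n)
          * (16 * ?n * (12 * ?n) ^ CARD('n) * real k) powr ?p / ?V powr (1 / ?n))
        = C * isoperimetric_ratio \<Omega> powr ?p * real k powr ?p"
      unfolding ratio C_def by (subst powr_mult) auto
    finally show ?thesis .
  qed simp
  with C show ?thesis by blast
qed

end
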